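(* Let $G$ be a finite simple unicycle graph, and let $C_k$ be its unique cycle. Then: (i) if $k=3$, then $\Psi(G)$ is a greedoid on $V(G)$; (ii) if $k=2q\geq 4$ is even, then $\Psi(G)$ is a greedoid on $V(G)$ if and only if every maximum matching of $G$ is uniquely restricted; (iii) if $k=2q+1\geq 5$ is odd, then $\Psi(G)$ is a greedoid on $V(G)$ if and only if for every $S\in\Psi(G)$ the induced subgraph $G[N[S]]$ is a König–Egerváry graph.
   Context: All graphs are finite, simple (undirected, no loops, no multiple edges). A unicycle graph is a graph containing exactly one cycle. For $A\subseteq V(G)$, $N(A)=\{v\in V(G)-A: v \text{ has a neighbor in } A\}$ and $N[A]=A\cup N(A)$; $G[X]$ denotes the subgraph induced by $X$. A stable set is a set of pairwise non-adjacent vertices; $\alpha(H)$ is the maximum size of a stable set of $H$ and $\Omega(H)$ the family of all maximum stable sets of $H$. A set $A\subseteq V(G)$ is a local maximum stable set of $G$ if $A\in\Omega(G[N[A]])$; $\Psi(G)$ is the family of all local maximum stable sets of $G$. A greedoid on a finite set $V$ is a pair $(V,\mathcal{F})$ with $\emptyset\neq\mathcal{F}\subseteq 2^V$ satisfying (accessibility) every non-empty $X\in\mathcal{F}$ contains some $x$ with $X-\{x\}\in\mathcal{F}$, and (exchange) for $X,Y\in\mathcal{F}$ with $|X|=|Y|+1$ there is $x\in X-Y$ with $Y\cup\{x\}\in\mathcal{F}$. A matching is a set of pairwise vertex-disjoint edges; $\mu(H)$ is the size of a maximum matching of $H$. A matching $M$ of $G$ is uniquely restricted if $M$ is the unique perfect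 matching of the subgraph induced by the vertices saturated by $M$. A graph $H$ is a König–Egerváry graph if $\alpha(H)+\mu(H)=|V(H)|$. *)

theory Defs
  imports Main "HOL-Library.Ramsey"
begin

record 'a graph =
  verts :: "'a set"
  edges :: "'a set set"

definition simple_graph :: "'a graph \<Rightarrow> bool" where
  "simple_graph G \<longleftrightarrow> finite (verts G) \<and> edges G \<subseteq> [verts G]\<^bsup>2\<^esup>"

definition subgraph :: "'a graph \<Rightarrow> 'a graph \<Rightarrow> bool" where
  "subgraph H G \<longleftrightarrow> verts H \<subseteq> verts G \<and> edges H \<subseteq> edges G"

(* Only applied to X contained in the vertex set of G. *)
definition induced :: "'a graph \<Rightarrow> 'a set \<Rightarrow> 'a graph" where
  "induced G X = \<lparr>verts = X, edges = {e \<in> edges G. e \<subseteq> X}\<rparr>"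

definition cycle_graph :: "'a graph \<Rightarrow> bool" where
  "cycle_graph C \<longleftrightarrow>
     (\<exists>vs. distinct vs \<and> length vs \<ge> 3 \<and> verts C = set vs \<and>
        edges C = {{vs ! i, vs ! (Suc i mod length vs)} | i. i < length vs})"

(* A cycle of G is a subgraph, so rotations and reversals of a closed walk give the same cycle. *)
definition is_cycle_of :: "'a graph \<Rightarrow> 'a graph \<Rightarrow> bool" where
  "is_cycle_of G C \<longleftrightarrow> subgraph C G \<and> cycle_graph C"

definition unicycle :: "'a graph \<Rightarrow> bool" where
  "unicycle G \<longleftrightarrow> (\<exists>!C. is_cycle_of G C)"

definition nbhd :: "'a graph \<Rightarrow> 'a set \<Rightarrow> 'a set" where
  "nbhd G A = {v \<in> verts G - A. \<exists>u\<in>A. {u, v} \<in> edges G}"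

definition closed_nbhd :: "'a graph \<Rightarrow> 'a set \<Rightarrow> 'a set" where
  "closed_nbhd G A = A \<union> nbhd G A"

definition stable_set :: "'a graph \<Rightarrow> 'a set \<Rightarrow> bool" where
  "stable_set G S \<longleftrightarrow> S \<subseteq> verts G \<and> indep S (edges G)"

definition stability_number :: "'a graph \<Rightarrow> nat" where
  "stability_number G = Max (card ` {S. stable_set G S})"

definition Omega :: "'a graph \<Rightarrow> 'a set set" where
  "Omega G = {S. stable_set G S \<and> card S = stability_number G}"

definition Psi :: "'a graph \<Rightarrow> 'a set set" where
  "Psi G = {A. A \<subseteq> verts G \<and> A \<in> Omega (induced G (closed_nbhd G A))}"

definition greedoid :: "'a set \<Rightarrow> 'a set set \<Rightarrow> bool" where
  "greedoid V F \<longleftrightarrow>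
     finite V \<and> F \<noteq> {} \<and> F \<subseteq> Pow V \<and>
     (\<forall>X\<in>F. X \<noteq> {} \<longrightarrow> (\<exists>x\<in>X. X - {x} \<in> F)) \<and>
     (\<forall>X\<in>F. \<forall>Y\<in>F. card X = card Y + 1 \<longrightarrow> (\<exists>x\<in>X - Y. Y \<union> {x} \<in> F))"

definition matching :: "'a graph \<Rightarrow> 'a set set \<Rightarrow> bool" where
  "matching G M \<longleftrightarrow> M \<subseteq> edges G \<and> pairwise disjnt M"

definition matching_number :: "'a graph \<Rightarrow> nat" where
  "matching_number G = Max (card ` {M. matching G M})"

definition maximum_matching :: "'a graph \<Rightarrow> 'a set set \<Rightarrow> bool" where
  "maximum_matching G M \<longleftrightarrow> matching G M \<and> card M = matching_number G"

definition perfect_matching :: "'a graph \<Rightarrow> 'a set set \<Rightarrow> bool" where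
  "perfect_matching G M \<longleftrightarrow> matching G M \<and> \<Union>M = verts G"

(* The vertices saturated by M are those in the union of its edges. *)
definition uniquely_restricted :: "'a graph \<Rightarrow> 'a set set \<Rightarrow> bool" where
  "uniquely_restricted G M \<longleftrightarrow>
     matching G M \<and>
     perfect_matching (induced G (\<Union>M)) M \<and>
     (\<forall>M'. perfect_matching (induced G (\<Union>M)) M' \<longrightarrow> M' = M)"

definition konig_egervary :: "'a graph \<Rightarrow> bool" where
  "konig_egervary G \<longleftrightarrow> stability_number G + matching_number G = card (verts G)"

end

theory Submission
  imports Defs
begin

text \<open>
  A stable set \<open>S\<close> is a local maximum stable set iff every stable \<open>T \<subseteq> N(S)\<close> satisfies Hall's condition
  \<open>|T| \<le> |N(T) \<inter> S|\<close>. If \<open>X\<close> and \<open>Y\<close> are local maximum stable sets, then so is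
  \<open>Y \<union> (X - N[Y])\<close>; applied along a chain of removals from \<open>X\<close> this yields the exchange property, so
  \<open>\<Psi>(G)\<close> is a greedoid iff it is accessible.

  If no vertex of \<open>S\<close> can be removed, then each \<open>x \<in> S\<close> lies in \<open>N(T)\<close> for some tight
  \<open>T \<subseteq> N(S - x)\<close>, where tight means \<open>|T| = |N(T) \<inter> S|\<close>. A tight stable set in which every vertex
  has two neighbours in \<open>S\<close> carries an even cycle. Otherwise some \<open>t \<in> T\<close> has a single neighbour
  \<open>s \<in> S\<close>, and adding \<open>t\<close> to the tight set that blocks \<open>s\<close> violates Hall's condition. A minimal
  violating subset of \<open>N(S)\<close> is connected through \<open>S\<close> but not stable, which gives an odd cycle with
  exactly one edge inside \<open>N(S)\<close>. Hence for an even cycle Hall's condition holds for all subsets of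
  \<open>N(S)\<close>, for an odd cycle the absence of violations (which is the Koenig-Egervary property of
  \<open>G[N[S]]\<close>) suffices for accessibility, and for a triangle the two edges inside \<open>N(S)\<close> obtained from
  two different pendant vertices contradict each other.

  In the even case, fix a maximum stable set \<open>S\<close>. Maximum matchings are exactly the matchings of
  \<open>V - S\<close> into \<open>S\<close>. Two of them with the same vertex set agree, because accessibility peels off the
  tight part on which they differ; conversely a blocked \<open>S\<close> has a minimal tight set without pendant
  vertices, which can be rematched.
\<close>

section \<open>Hall's theorem\<close>

text \<open>Induction on the size of \<open>A\<close>. If a nonempty proper subset \<open>T\<close>
  is tight, \<open>T\<close> and \<open>A - T\<close> are matched separately, the latter avoiding
  all values open to \<open>T\<close>. Otherwise every nonempty proper subset has a surplus, which
  absorbs fixing an arbitrary value for one element.\<close>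

lemma hall_marriage:
  fixes N :: "'a \<Rightarrow> 'b set"
  assumes "finite A" and "\<And>a. a \<in> A \<Longrightarrow> finite (N a)"
    and "\<And>T. T \<subseteq> A \<Longrightarrow> card T \<le> card (\<Union>(N ` T))"
  shows "\<exists>f. inj_on f A \<and> (\<forall>a\<in>A. f a \<in> N a)"
  using assms
proof (induction "card A" arbitrary: A N rule: less_induct)
  case less
  note fin = less.prems(1) and finN = less.prems(2) and hall = less.prems(3)
  show ?case
  proof (cases "A = {}")
    case True
    then show ?thesis by simp
  next
    case False
    show ?thesis
    proof (cases "\<exists>T. T \<noteq> {} \<and> T \<subset> A \<and> card (\<Union>(N ` T)) = card T")
      case True
      then obtain T where T: "T \<noteq> {}" "T \<subset> A" "card (\<Union>(N ` T)) = card T"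
        by blast
      have finT: "finite T"
        using T fin by (meson finite_subset psubset_imp_subset)
      have "\<exists>f. inj_on f T \<and> (\<forall>a\<in>T. f a \<in> N a)"
      proof (rule less.hyps)
        show "card T < card A"
          using T fin by (simp add: psubset_card_mono)
        show "card U \<le> card (\<Union>(N ` U))" if "U \<subseteq> T" for U
          using hall that T by blast
      qed (use finT finN T in auto)
      then obtain f where f: "inj_on f T" "\<And>a. a \<in> T \<Longrightarrow> f a \<in> N a"
        by blast
      let ?N = "\<lambda>a. N a - \<Union>(N ` T)"
      have "\<exists>g. inj_on g (A - T) \<and> (\<forall>a\<in>A - T. g a \<in> ?N a)"
      proof (rule less.hyps)
        show "card (A - T) < card A"
          using T fin by (metis card_Diff_subset card_gt_0_iff card_mono
              diff_less finT less_le_trans psubset_imp_subset)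
        show "card U \<le> card (\<Union>(?N ` U))" if U: "U \<subseteq> A - T" for U
        proof -
          have "finite U"
            using U fin by (meson finite_Diff finite_subset)
          then have "card U + card T = card (U \<union> T)"
            using U finT by (subst card_Un_disjoint) auto
          also have "\<dots> \<le> card (\<Union>(N ` (U \<union> T)))"
            using hall U T by (metis Diff_subset Un_least psubset_imp_subset subset_trans)
          also have "\<Union>(N ` (U \<union> T)) = \<Union>(?N ` U) \<union> \<Union>(N ` T)"
            by blast
          also have "card \<dots> \<le> card (\<Union>(?N ` U)) + card (\<Union>(N ` T))"
            by (rule card_Un_le)
          finally show ?thesis
            using T by simp
        qed
      qed (use fin finN in auto)
      then obtain g where g: "inj_on g (A - T)" "\<And>a. a \<in> A - T \<Longrightarrow> g a \<in> ?N a"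
        by blast
      let ?h = "\<lambda>a. if a \<in> T then f a else g a"
      have "inj_on ?h A"
        using f g unfolding inj_on_def by (smt (verit) DiffD2 DiffI UN_I)
      moreover have "\<forall>a\<in>A. ?h a \<in> N a"
        using f g by auto
      ultimately show ?thesis by (intro exI[of _ ?h]) simp
    next
      case noT: False
      obtain a where a: "a \<in> A"
        using False by blast
      have "card {a} \<le> card (N a)"
        using hall[of "{a}"] a by simp
      then obtain b where b: "b \<in> N a"
        by fastforce
      let ?N = "\<lambda>x. N x - {b}"
      have "\<exists>g. inj_on g (A - {a}) \<and> (\<forall>x\<in>A - {a}. g x \<in> ?N x)"
      proof (rule less.hyps)
        show "card (A - {a}) < card A"
          using a fin by (rule card_Diff1_less[rotated])
        show "card U \<le> card (\<Union>(?N ` U))" if U: "U \<subseteq> A - {a}" for U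
        proof (cases "U = {}")
          case nonempty: False
          have sub: "U \<subset> A"
            using U a by blast
          then have "card U < card (\<Union>(N ` U))"
            using noT nonempty hall[of U] by (metis le_neq_implies_less psubset_imp_subset)
          moreover have "\<Union>(?N ` U) = \<Union>(N ` U) - {b}"
            by blast
          moreover have "card (\<Union>(N ` U)) - 1 \<le> card (\<Union>(N ` U) - {b})"
            by (metis card_Diff_singleton_if diff_le_self order_refl)
          ultimately show ?thesis
            by simp
        qed simp
      qed (use fin finN in auto)
      then obtain g where g: "inj_on g (A - {a})" "\<And>x. x \<in> A - {a} \<Longrightarrow> g x \<in> ?N x"
        by blast
      have "inj_on (g(a := b)) A"
        using g unfolding inj_on_def by (auto simp: fun_upd_def)
      moreover have "\<forall>x\<in>A. (g(a := b)) x \<in> N x"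
        using g b by auto
      ultimately show ?thesis by blast
    qed
  qed
qed

section \<open>Local maximum stable sets\<close>

lemma Omega_iff:
  assumes "finite (verts H)"
  shows "S \<in> Omega H \<longleftrightarrow> stable_set H S \<and> (\<forall>T. stable_set H T \<longrightarrow> card T \<le> card S)"
proof -
  have fin: "finite (card ` {S. stable_set H S})"
    by (rule finite_imageI, rule finite_subset[of _ "Pow (verts H)"])
      (use assms in \<open>auto simp: stable_set_def\<close>)
  show ?thesis
  proof
    assume S: "S \<in> Omega H"
    then have "card T \<le> card S" if "stable_set H T" for T
      using that fin by (auto simp: Omega_def stability_number_def intro!: Max_ge)
    with S show "stable_set H S \<and> (\<forall>T. stable_set H T \<longrightarrow> card T \<le> card S)"
      by (auto simp: Omega_def)
  next
    assume S: "stable_set H S \<and> (\<forall>T. stable_set H T \<longrightarrow> card T \<le> card S)"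
    then have "Max (card ` {S. stable_set H S}) = card S"
      using fin by (intro Max_eqI) auto
    then show "S \<in> Omega H"
      using S by (simp add: Omega_def stability_number_def)
  qed
qed

locale fin_simple_graph =
  fixes G :: "'a graph"
  assumes simple: "simple_graph G"
begin

abbreviation V where "V \<equiv> verts G"
abbreviation E where "E \<equiv> edges G"

definition adj :: "'a \<Rightarrow> 'a \<Rightarrow> bool" where
  "adj u v \<longleftrightarrow> {u, v} \<in> E"

text \<open>For \<open>T\<close> outside \<open>S\<close> this is the intersection of N(T) with
  \<open>S\<close>. With \<open>S\<close> fixed, the sets \<open>nbrs S {t}\<close> form the set
  system to which Hall's theorem is applied.\<close>

definition nbrs :: "'a set \<Rightarrow> 'a set \<Rightarrow> 'a set" where
  "nbrs S T = {s \<in> S. \<exists>t\<in>T. adj s t}"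

lemma finite_V: "finite V"
  using simple by (simp add: simple_graph_def)

lemma finite_sub: "S \<subseteq> V \<Longrightarrow> finite S"
  using finite_V by (rule finite_subset[rotated])

lemma edgeD:
  assumes "e \<in> E"
  shows "\<exists>u v. e = {u, v} \<and> u \<noteq> v \<and> u \<in> V \<and> v \<in> V"
proof -
  have "e \<subseteq> V" "card e = 2"
    using assms simple by (auto simp: simple_graph_def nsets_def)
  then show ?thesis by (auto simp: card_2_iff)
qed

lemma adjD:
  assumes "adj u v"
  shows "u \<noteq> v" "u \<in> V" "v \<in> V"
  using edgeD[of "{u, v}"] assms by (auto simp: adj_def doubleton_eq_iff)

lemma adj_sym: "adj u v \<Longrightarrow> adj v u"
  by (simp add: adj_def insert_commute)

lemma nbrs_sub: "nbrs S T \<subseteq> S"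
  by (auto simp: nbrs_def)

lemma nbrs_UN: "\<Union>((\<lambda>t. nbrs S {t}) ` T) = nbrs S T"
  by (auto simp: nbrs_def)

lemma nbhd_sub: "nbhd G S \<subseteq> V - S"
  by (auto simp: nbhd_def)

lemma closed_nbhd_sub: "S \<subseteq> V \<Longrightarrow> closed_nbhd G S \<subseteq> V"
  by (auto simp: nbhd_def closed_nbhd_def)

lemma nbhd_iff: "v \<in> nbhd G S \<longleftrightarrow> v \<notin> S \<and> (\<exists>s\<in>S. adj s v)"
  using adjD by (auto simp: nbhd_def adj_def)

lemma indepD: "indep S E \<Longrightarrow> u \<in> S \<Longrightarrow> v \<in> S \<Longrightarrow> \<not> adj u v"
  using adjD unfolding indep_def adj_def by blast

lemma indepI: "(\<And>u v. u \<in> S \<Longrightarrow> v \<in> S \<Longrightarrow> \<not> adj u v) \<Longrightarrow> indep S E"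
  unfolding indep_def adj_def by blast

lemma verts_induced [simp]: "verts (induced G X) = X"
  by (simp add: induced_def)

lemma stable_induced:
  "stable_set (induced G X) T \<longleftrightarrow> T \<subseteq> X \<and> indep T E"
  by (auto simp: stable_set_def induced_def indep_def)

text \<open>Exchanging \<open>nbrs S T\<close> for \<open>T\<close> turns \<open>S\<close> into a
  competing stable set, so maximality forces the inequality. Conversely, a competitor
  \<open>T\<close> differs from \<open>S\<close> by \<open>T - S\<close>, whose neighbours in
  \<open>S\<close> all lie in \<open>S - T\<close> because \<open>T\<close> is stable.\<close>

lemma Psi_iff:
  "S \<in> Psi G \<longleftrightarrow> S \<subseteq> V \<and> indep S E \<and>
     (\<forall>T \<subseteq> nbhd G S. indep T E \<longrightarrow> card T \<le> card (nbrs S T))" (is "_ \<longleftrightarrow> ?R")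
proof (cases "S \<subseteq> V")
  case True
  have finS: "finite S" and finN: "finite (closed_nbhd G S)"
    using True closed_nbhd_sub finite_sub by blast+
  have Psi: "S \<in> Psi G \<longleftrightarrow> indep S E \<and>
      (\<forall>T. T \<subseteq> closed_nbhd G S \<and> indep T E \<longrightarrow> card T \<le> card S)"
    using True finN
    by (auto simp: Psi_def Omega_iff stable_induced closed_nbhd_def)
  show ?thesis
  proof
    assume S: "S \<in> Psi G"
    have "card T \<le> card (nbrs S T)" if T: "T \<subseteq> nbhd G S" "indep T E" for T
    proof -
      have fin: "finite T" "finite (nbrs S T)"
        using T nbhd_sub finite_sub finite_subset[OF nbrs_sub finS] by blast+
      have "indep (T \<union> (S - nbrs S T)) E"
        using S Psi indepD T(2) adj_sym by (intro indepI) (auto simp: nbrs_def)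
      moreover have "T \<union> (S - nbrs S T) \<subseteq> closed_nbhd G S"
        using T by (auto simp: closed_nbhd_def)
      ultimately have "card (T \<union> (S - nbrs S T)) \<le> card S"
        using S Psi by blast
      moreover have "card (T \<union> (S - nbrs S T)) = card T + (card S - card (nbrs S T))"
        using T fin finS nbhd_sub[of S]
        by (subst card_Un_disjoint) (auto simp: card_Diff_subset nbrs_sub)
      moreover have "card (nbrs S T) \<le> card S"
        using finS nbrs_sub by (rule card_mono)
      ultimately show ?thesis by linarith
    qed
    with S Psi True show ?R by blast
  next
    assume R: ?R
    have "card T \<le> card S" if T: "T \<subseteq> closed_nbhd G S" "indep T E" for T
    proof -
      have finT: "finite T"
        using T(1) finN by (rule finite_subset)
      have "card (T - S) \<le> card (nbrs S (T - S))"
        using R T(1) smaller_indep[OF T(2), of "T - S"]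
        by (metis Diff_subset Diff_subset_conv closed_nbhd_def)
      also have "\<dots> \<le> card (S - T)"
        using T finS indepD by (intro card_mono) (auto simp: nbrs_def)
      finally have "card (T - S) + card (T \<inter> S) \<le> card (S - T) + card (S \<inter> T)"
        by (simp add: Int_commute)
      moreover have "card T = card (T - S) + card (T \<inter> S)"
        using finT by (metis Int_Diff_Un Int_Diff_disjoint card_Un_disjoint finite_Diff finite_Int add.commute)
      moreover have "card S = card (S - T) + card (S \<inter> T)"
        using finS by (metis Int_Diff_Un Int_Diff_disjoint card_Un_disjoint finite_Diff finite_Int add.commute)
      ultimately show ?thesis by linarith
    qed
    then show "S \<in> Psi G"
      using R Psi by blast
  qed
qed (auto simp: Psi_def)

lemma PsiD:
  assumes "S \<in> Psi G"
  shows "S \<subseteq> V" "indep S E" "finite S"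
    "\<And>T. T \<subseteq> nbhd G S \<Longrightarrow> indep T E \<Longrightarrow> card T \<le> card (nbrs S T)"
  using assms finite_sub by (auto simp: Psi_iff)

lemma empty_Psi: "{} \<in> Psi G"
  by (auto simp: Psi_iff indep_def nbhd_def)

text \<open>The part of \<open>T\<close> adjacent to \<open>Y\<close> is bounded by Hall's condition
  for \<open>Y\<close>. The rest, \<open>T2\<close>, is bounded by Hall's condition for
  \<open>X\<close>, once its possible neighbours in the discarded part \<open>P\<close> of
  \<open>X\<close> are compensated.\<close>

lemma Psi_extend:
  assumes X: "X \<in> Psi G" and Y: "Y \<in> Psi G"
  shows "Y \<union> (X - closed_nbhd G Y) \<in> Psi G" (is "?Z \<in> _")
  unfolding Psi_iff
proof (intro conjI allI impI)
  note x = PsiD[OF X] and y = PsiD[OF Y]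
  show "?Z \<subseteq> V" using x y by blast
  show "indep ?Z E"
    using indepD[OF x(2)] indepD[OF y(2)] adj_sym
    by (intro indepI) (auto simp: closed_nbhd_def nbhd_iff)
  fix T assume T: "T \<subseteq> nbhd G ?Z" "indep T E"
  define T1 where "T1 = T \<inter> nbhd G Y"
  define T2 where "T2 = T - nbhd G Y"
  define P where "P = X \<inter> nbhd G Y"
  have finT: "finite T"
    using T nbhd_sub finite_sub by blast
  have c1: "card T1 \<le> card (nbrs Y T1)"
    using T by (intro y(4)) (auto simp: T1_def intro: smaller_indep)
  have T2Y: "\<not> adj s t" "\<not> adj t s" if "t \<in> T2" "s \<in> Y" for s t
    using that T nbhd_sub[of ?Z] adj_sym by (auto simp: T2_def nbhd_iff[of t Y])
  have T2sub: "t \<notin> Y \<and> t \<notin> X - closed_nbhd G Y \<and> (\<exists>s\<in>?Z. adj s t)" if "t \<in> T" for t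
    using that T by (auto simp: nbhd_iff)
  have T2': "t \<notin> X \<and> (\<exists>s\<in>X. adj s t)" if "t \<in> T2" for t
    using T2sub[of t] T2Y[of t] that by (auto simp: T2_def closed_nbhd_def)
  \<comment> \<open>Together with \<open>T2\<close>, the neighbours of \<open>P\<close> in
    \<open>Y\<close> are adjacent, within \<open>X\<close>, only to \<open>P\<close> and
    \<open>X - closed_nbhd G Y\<close>. Since \<open>P\<close> is no larger than
    \<open>nbrs Y P\<close>, both terms drop out of Hall's condition for \<open>W\<close>.\<close>
  define W where "W = T2 \<union> nbrs Y P"
  have "card W \<le> card (nbrs X W)"
  proof (rule x(4))
    show "W \<subseteq> nbhd G X"
      using T2' indepD[OF x(2)] adj_sym by (fastforce simp: W_def nbrs_def P_def nbhd_iff)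
    show "indep W E"
    proof (rule indepI)
      have "\<not> adj u v" if "u \<in> T2" "v \<in> T2" for u v
        using that indepD[OF T(2)] by (auto simp: T2_def)
      then show "\<not> adj u v" if "u \<in> W" "v \<in> W" for u v
        using that T2Y indepD[OF y(2)] by (auto simp: W_def nbrs_def)
    qed
  qed
  moreover have "card W = card T2 + card (nbrs Y P)"
    unfolding W_def using finT y(3) T
    by (intro card_Un_disjoint) (auto simp: T2_def nbrs_def nbhd_iff)
  moreover have "card P \<le> card (nbrs Y P)"
    by (intro y(4)) (auto simp: P_def intro: smaller_indep[OF x(2)])
  moreover have "nbrs X W \<subseteq> P \<union> nbrs (X - closed_nbhd G Y) T2"
  proof
    fix z assume "z \<in> nbrs X W"
    then obtain w where z: "z \<in> X" "w \<in> W" "adj z w"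
      by (auto simp: nbrs_def)
    show "z \<in> P \<union> nbrs (X - closed_nbhd G Y) T2"
    proof (cases "z \<in> nbhd G Y")
      case False
      then have "w \<notin> Y" "z \<notin> Y"
        using z adj_sym[of z w] indepD[OF y(2)] T2Y by (auto simp: nbhd_iff W_def nbrs_def)
      with False z show ?thesis
        by (auto simp: W_def nbrs_def closed_nbhd_def)
    qed (use z in \<open>simp add: P_def\<close>)
  qed
  then have "card (nbrs X W) \<le> card P + card (nbrs (X - closed_nbhd G Y) T2)"
    using x(3) by (intro order_trans[OF card_mono card_Un_le]) (auto simp: P_def nbrs_def)
  ultimately have c2: "card T2 \<le> card (nbrs (X - closed_nbhd G Y) T2)"
    by linarith
  have "card T = card T1 + card T2"
    using finT unfolding T1_def T2_def
    by (metis Int_Diff_Un Int_Diff_disjoint card_Un_disjoint finite_Diff finite_Int)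
  also have "\<dots> \<le> card (nbrs Y T1) + card (nbrs (X - closed_nbhd G Y) T2)"
    using c1 c2 by linarith
  also have "\<dots> = card (nbrs Y T1 \<union> nbrs (X - closed_nbhd G Y) T2)"
    using x(3) y(3) by (intro card_Un_disjoint[symmetric]) (auto simp: nbrs_def closed_nbhd_def)
  also have "\<dots> \<le> card (nbrs ?Z T)"
    using x(3) y(3) by (intro card_mono) (auto simp: nbrs_def T1_def T2_def)
  finally show "card T \<le> card (nbrs ?Z T)" .
qed

section \<open>Reduction of the greedoid axioms to accessibility\<close>

definition accessible :: bool where
  "accessible \<longleftrightarrow> (\<forall>X\<in>Psi G. X \<noteq> {} \<longrightarrow> (\<exists>x\<in>X. X - {x} \<in> Psi G))"

text \<open>Vertices are removed from \<open>X\<close> by accessibility until the next removal would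
  leave a subset of \<open>closed_nbhd G Y\<close>. At that point exactly one vertex of
  \<open>X\<close> lies outside, and \<open>Psi_extend\<close> adds precisely this vertex to
  \<open>Y\<close>.\<close>

lemma exchange_aux:
  assumes acc: accessible and Y: "Y \<in> Psi G"
    and "X \<in> Psi G" and "\<not> X \<subseteq> closed_nbhd G Y"
  shows "\<exists>x\<in>X - Y. Y \<union> {x} \<in> Psi G"
  using assms(3,4)
proof (induction "card X" arbitrary: X rule: less_induct)
  case less
  then have "X \<noteq> {}" by blast
  then obtain x where x: "x \<in> X" "X - {x} \<in> Psi G"
    using acc less.prems by (auto simp: accessible_def)
  show ?case
  proof (cases "X - {x} \<subseteq> closed_nbhd G Y")
    case True
    then have "X - closed_nbhd G Y = {x}"
      using less.prems by blast
    then show ?thesis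
      using Psi_extend[OF less.prems(1) Y] by (auto simp: closed_nbhd_def)
  next
    case False
    have "card (X - {x}) < card X"
      using x PsiD(3)[OF less.prems(1)] by (metis card_Diff1_less)
    from less.hyps[OF this x(2) False] show ?thesis by blast
  qed
qed

lemma greedoid_iff: "greedoid V (Psi G) \<longleftrightarrow> accessible"
proof
  assume acc: accessible
  have "\<exists>x\<in>X - Y. Y \<union> {x} \<in> Psi G"
    if X: "X \<in> Psi G" and Y: "Y \<in> Psi G" and c: "card X = card Y + 1" for X Y
  proof (rule exchange_aux[OF acc Y X])
    show "\<not> X \<subseteq> closed_nbhd G Y"
    proof
      assume "X \<subseteq> closed_nbhd G Y"
      then have "card X \<le> card Y"
        using Y PsiD[OF X] PsiD[OF Y] closed_nbhd_sub[of Y] finite_sub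
        by (auto simp: Psi_def Omega_iff stable_induced)
      with c show False by simp
    qed
  qed
  then show "greedoid V (Psi G)"
    using acc finite_V empty_Psi PsiD(1) unfolding greedoid_def accessible_def by blast
qed (simp add: greedoid_def accessible_def)

end

section \<open>Alternating cycles\<close>

lemma rtranclp_distinct_path:
  assumes "r\<^sup>*\<^sup>* x y"
  shows "\<exists>vs. distinct vs \<and> vs \<noteq> [] \<and> hd vs = x \<and> last vs = y \<and>
    (\<forall>i. Suc i < length vs \<longrightarrow> r (vs ! i) (vs ! Suc i))"
  using assms
proof induction
  case base
  show ?case by (intro exI[of _ "[x]"]) simp
next
  case (step y z)
  then obtain vs where vs: "distinct vs" "vs \<noteq> []" "hd vs = x" "last vs = y"
    and r: "\<And>i. Suc i < length vs \<Longrightarrow> r (vs ! i) (vs ! Suc i)" by blast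
  show ?case
  proof (cases "z \<in> set vs")
    case True
    then obtain as bs where ab: "vs = as @ z # bs"
      by (meson split_list)
    have "r ((as @ [z]) ! i) ((as @ [z]) ! Suc i)" if "Suc i < length (as @ [z])" for i
      using r[of i] that by (auto simp: ab nth_append less_Suc_eq)
    then show ?thesis
      using vs ab by (intro exI[of _ "as @ [z]"]) (auto simp: hd_append split: if_splits)
  next
    case False
    have "r ((vs @ [z]) ! i) ((vs @ [z]) ! Suc i)" if i: "Suc i < length (vs @ [z])" for i
    proof (cases "Suc i < length vs")
      case True
      then show ?thesis using r[of i] by (simp add: nth_append)
    next
      case False
      then have "i = length vs - 1"
        using i by simp
      then show ?thesis
        using step.hyps(2) vs(2,4) by (simp add: nth_append last_conv_nth)
    qed
    then show ?thesis
      using vs False by (intro exI[of _ "vs @ [z]"]) auto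
  qed
qed

context fin_simple_graph
begin

lemma cycle_of_list:
  assumes "distinct vs" and len: "3 \<le> length vs"
    and step: "\<And>i. Suc i < length vs \<Longrightarrow> adj (vs ! i) (vs ! Suc i)"
    and close: "adj (last vs) (hd vs)"
  shows "\<exists>C. is_cycle_of G C \<and> verts C = set vs"
proof -
  have ne: "vs \<noteq> []" using len by auto
  have e: "adj (vs ! i) (vs ! (Suc i mod length vs))" if "i < length vs" for i
  proof (cases "Suc i < length vs")
    case True
    then show ?thesis using step by simp
  next
    case False
    then have "Suc i = length vs" using that by simp
    then show ?thesis
      using close ne by (metis diff_Suc_1 hd_conv_nth last_conv_nth mod_self)
  qed
  let ?C = "\<lparr>verts = set vs, edges = {{vs ! i, vs ! (Suc i mod length vs)} | i. i < length vs}\<rparr>"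
  have "set vs \<subseteq> V"
    using e adjD(2) by (metis in_set_conv_nth subsetI)
  then have "subgraph ?C G"
    using e by (auto simp: subgraph_def adj_def)
  moreover have "cycle_graph ?C"
    using assms(1) len unfolding cycle_graph_def by (intro exI[of _ vs]) auto
  ultimately show ?thesis
    by (intro exI[of _ ?C]) (simp add: is_cycle_of_def)
qed

text \<open>Unlike in \<open>Psi_iff\<close>, \<open>T\<close> need not be stable. By Hall's theorem
  this says that the whole of N(S) can be matched into \<open>S\<close>.\<close>

definition hall_local :: "'a set \<Rightarrow> bool" where
  "hall_local S \<longleftrightarrow> (\<forall>T \<subseteq> nbhd G S. card T \<le> card (nbrs S T))"

lemma finite_nbhd: "T \<subseteq> nbhd G S \<Longrightarrow> finite T"
  using nbhd_sub finite_sub by blast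

text \<open>A smallest violating set \<open>Y\<close> contains an edge \<open>uv\<close>, since
  stable sets obey Hall's condition, and it is connected through \<open>S\<close>. A path from
  \<open>u\<close> to \<open>v\<close> alternating between \<open>Y\<close> and \<open>S\<close> has
  an odd number of vertices, and the edge \<open>uv\<close> closes it.\<close>

lemma odd_alternating_cycle:
  assumes S: "S \<in> Psi G" and Z: "Z \<subseteq> nbhd G S" and viol: "card (nbrs S Z) < card Z"
  shows "\<exists>vs. distinct vs \<and> odd (length vs) \<and> 3 \<le> length vs \<and>
    (\<forall>i<length vs. vs ! i \<in> (if even i then Z else S)) \<and>
    (\<forall>i. Suc i < length vs \<longrightarrow> adj (vs ! i) (vs ! Suc i)) \<and> adj (last vs) (hd vs)"
proof -
  obtain Y where Y: "Y \<subseteq> Z" "card (nbrs S Y) < card Y"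
    and least: "\<And>X. X \<subseteq> Z \<Longrightarrow> card (nbrs S X) < card X \<Longrightarrow> card Y \<le> card X"
    using ex_has_least_nat[of "\<lambda>Y. Y \<subseteq> Z \<and> card (nbrs S Y) < card Y" Z card] viol by blast
  have finY: "finite Y"
    using Y Z finite_nbhd by blast
  have finS: "finite S" and YS: "Y \<inter> S = {}"
    using PsiD[OF S] Y Z nbhd_sub by blast+
  have small: "card X \<le> card (nbrs S X)" if "X \<subset> Y" for X
    using least[of X] that Y finY psubset_card_mono[OF finY that] by force
  have "\<not> indep Y E"
    using PsiD(4)[OF S, of Y] Y Z by force
  then obtain u v where uv: "u \<in> Y" "v \<in> Y" "adj u v"
    using indepI by blast
  define r where "r a b \<longleftrightarrow> adj a b \<and> (a \<in> Y \<and> b \<in> S \<or> a \<in> S \<and> b \<in> Y)" for a b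
  have "r\<^sup>*\<^sup>* u v"
  proof (rule ccontr)
    assume nr: "\<not> r\<^sup>*\<^sup>* u v"
    \<comment> \<open>The vertices of \<open>Y\<close> reachable from \<open>u\<close> and the
      remaining ones would have disjoint neighbourhoods in \<open>S\<close>. Both are proper subsets
      and obey Hall's condition, which adds up to Hall's condition for \<open>Y\<close>.\<close>
    define R where "R = {y \<in> Y. r\<^sup>*\<^sup>* u y}"
    have R: "R \<subset> Y" "Y - R \<subset> Y"
      using uv nr by (auto simp: R_def)
    have disj: "nbrs S R \<inter> nbrs S (Y - R) = {}"
    proof (rule ccontr)
      assume "nbrs S R \<inter> nbrs S (Y - R) \<noteq> {}"
      then obtain s y y' where s: "s \<in> S" "y \<in> R" "y' \<in> Y - R" "adj s y" "adj s y'"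
        by (auto simp: nbrs_def)
      then have "r y s" "r s y'"
        by (auto simp: r_def R_def intro: adj_sym)
      moreover have "r\<^sup>*\<^sup>* u y"
        using s by (simp add: R_def)
      ultimately have "r\<^sup>*\<^sup>* u y'"
        by (meson rtranclp.rtrancl_into_rtrancl)
      with s show False
        by (simp add: R_def)
    qed
    have "card Y = card R + card (Y - R)"
      using finY R by (metis card_Un_disjoint Diff_disjoint Un_Diff_cancel finite_Diff
          finite_subset psubset_imp_subset sup.absorb_iff2)
    also have "\<dots> \<le> card (nbrs S R) + card (nbrs S (Y - R))"
      using small R by (intro add_mono) auto
    also have "\<dots> = card (nbrs S R \<union> nbrs S (Y - R))"
      using disj finS by (intro card_Un_disjoint[symmetric]) (auto simp: nbrs_def)
    also have "\<dots> \<le> card (nbrs S Y)"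
      using finS by (intro card_mono) (auto simp: nbrs_def R_def)
    finally show False using Y by simp
  qed
  then obtain vs where vs: "distinct vs" "vs \<noteq> []" "hd vs = u" "last vs = v"
    and step: "\<And>i. Suc i < length vs \<Longrightarrow> r (vs ! i) (vs ! Suc i)"
    using rtranclp_distinct_path by metis
  have par: "vs ! i \<in> (if even i then Y else S)" if "i < length vs" for i
    using that
  proof (induction i)
    case 0
    then show ?case using vs uv by (simp add: hd_conv_nth)
  next
    case (Suc i)
    then have "vs ! i \<in> (if even i then Y else S)" by simp
    then show ?case
      using step[OF Suc.prems] YS by (auto simp: r_def)
  qed
  have "vs ! (length vs - 1) \<in> Y"
    using vs uv by (simp add: last_conv_nth)
  then have "even (length vs - 1)"
    using par[of "length vs - 1"] vs YS by (auto split: if_splits)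
  then have odd: "odd (length vs)"
    using vs by (cases vs) auto
  have "length vs \<noteq> 1"
    using vs uv adjD(1)[of u u] by (auto simp: length_Suc_conv)
  then have "3 \<le> length vs"
    using odd by presburger
  moreover have "adj (last vs) (hd vs)"
    using vs uv adj_sym by simp
  moreover have "vs ! i \<in> (if even i then Z else S)" if "i < length vs" for i
    using par[OF that] Y by auto
  ultimately show ?thesis
    using vs odd step by (intro exI[of _ vs]) (auto simp: r_def)
qed

lemma hall_local_if_no_odd_cycle:
  assumes S: "S \<in> Psi G" and "\<And>C. is_cycle_of G C \<Longrightarrow> even (card (verts C))"
  shows "hall_local S"
proof (rule ccontr)
  assume "\<not> hall_local S"
  then obtain Z where "Z \<subseteq> nbhd G S" "card (nbrs S Z) < card Z"
    by (auto simp: hall_local_def not_le)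
  from odd_alternating_cycle[OF S this] obtain vs where vs: "distinct vs" "odd (length vs)"
    "3 \<le> length vs" "\<forall>i. Suc i < length vs \<longrightarrow> adj (vs ! i) (vs ! Suc i)" "adj (last vs) (hd vs)"
    by blast
  then obtain C where "is_cycle_of G C" "verts C = set vs"
    using cycle_of_list[of vs] by blast
  then show False
    using assms(2)[of C] vs by (simp add: distinct_card)
qed

text \<open>Going from \<open>t\<close> to a second neighbour \<open>g t\<close> among the matched
  vertices and back along the matching defines a map \<open>h\<close> on the finite set
  \<open>T\<close>. It has no fixed point, and a periodic orbit of length \<open>p\<close> traces a
  cycle with \<open>2 * p\<close> vertices.\<close>

lemma even_alternating_cycle:
  assumes fin: "finite T" and ne: "T \<noteq> {}" and inj: "inj_on f T" and disj: "f ` T \<inter> T = {}"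
    and adjf: "\<And>t. t \<in> T \<Longrightarrow> adj t (f t)"
    and other: "\<And>t. t \<in> T \<Longrightarrow> \<exists>s\<in>f ` T. s \<noteq> f t \<and> adj t s"
  shows "\<exists>C. is_cycle_of G C \<and> even (card (verts C))"
proof -
  obtain g where g: "\<And>t. t \<in> T \<Longrightarrow> g t \<in> f ` T \<and> g t \<noteq> f t \<and> adj t (g t)"
    using other by metis
  define h where "h t = inv_into T f (g t)" for t
  have hT: "h t \<in> T" and fh: "f (h t) = g t" and hne: "h t \<noteq> t" if "t \<in> T" for t
    using g[OF that] by (auto simp: h_def inv_into_into f_inv_into_f)
  have pT: "(h ^^ n) t \<in> T" if "t \<in> T" for n t
    using that by (induction n) (auto intro: hT)
  \<comment> \<open>The period is minimised over all points of \<open>T\<close> at once, which makes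
    the first \<open>p\<close> points of the chosen orbit distinct.\<close>
  define P where "P p \<longleftrightarrow> 0 < p \<and> (\<exists>u\<in>T. (h ^^ p) u = u)" for p
  have "\<exists>p. P p"
  proof -
    obtain t where t: "t \<in> T" using ne by blast
    have "\<not> inj (\<lambda>n. (h ^^ n) t)"
      using pT[OF t] fin by (metis finite_imageD finite_subset image_subsetI infinite_UNIV_nat)
    then obtain i j where ij: "i < j" "(h ^^ i) t = (h ^^ j) t"
      unfolding inj_def by (metis linorder_neqE_nat)
    then have "(h ^^ (j - i)) ((h ^^ i) t) = (h ^^ i) t"
      by (metis add_diff_cancel_right' comp_apply funpow_add le_add_diff_inverse2 less_imp_le_nat)
    then show ?thesis
      using ij pT[OF t] by (intro exI[of _ "j - i"]) (auto simp: P_def)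
  qed
  define p where "p = (LEAST p. P p)"
  have "P p" and minp: "\<And>q. q < p \<Longrightarrow> \<not> P q"
    using \<open>\<exists>p. P p\<close> unfolding p_def by (auto intro: LeastI dest: not_less_Least)
  then obtain u where u: "u \<in> T" "(h ^^ p) u = u" "0 < p"
    by (auto simp: P_def)
  have "p \<noteq> 1"
    using u hne by auto
  then have p2: "2 \<le> p" using u by simp
  define w where "w n = (h ^^ n) u" for n
  have wT: "w n \<in> T" for n
    using pT u by (simp add: w_def)
  have wS: "w (Suc n) = h (w n)" for n
    by (simp add: w_def)
  have lt: "w i \<noteq> w j" if "i < j" "j < p" for i j
  proof
    assume "w i = w j"
    then have "(h ^^ (j - i)) (w i) = w i"
      using that unfolding w_def
      by (metis add_diff_cancel_right' comp_apply funpow_add le_add_diff_inverse2 less_imp_le_nat)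
    then show False
      using minp[of "j - i"] that wT[of i] by (auto simp: P_def)
  qed
  then have winj: "w i = w j \<Longrightarrow> i < p \<Longrightarrow> j < p \<Longrightarrow> i = j" for i j
    by (metis linorder_neqE_nat)
  have gw: "g (w n) = f (w (Suc n))" for n
    using fh[OF wT] wS by simp
  have wp: "w p = w 0"
    using u by (simp add: w_def)
  have gwinj: "i = j" if "g (w i) = g (w j)" "i < p" "j < p" for i j
  proof -
    have "w (Suc i) = w (Suc j)"
      using that inj wT by (simp add: gw inj_on_eq_iff)
    moreover have "w 0 \<noteq> w (Suc k)" if "Suc k < p" for k
      using lt[OF _ that] by simp
    moreover have "Suc i = p \<or> Suc i < p" "Suc j = p \<or> Suc j < p"
      using that by auto
    ultimately show ?thesis
      using wp winj[of "Suc i" "Suc j"] by (metis nat.inject)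
  qed
  have gwT: "g (w i) \<noteq> w j" for i j
    using g[OF wT] wT disj by (metis disjoint_iff)
  \<comment> \<open>Even positions carry the orbit, odd positions the second neighbours. Since
    \<open>g (w n) = f (w (Suc n))\<close>, non-matching and matching edges alternate.\<close>
  define F where "F i = (if even i then w (i div 2) else g (w (i div 2)))" for i
  define vs where "vs = map F [0..<2 * p]"
  have len: "length vs = 2 * p" by (simp add: vs_def)
  have nth: "vs ! i = F i" if "i < 2 * p" for i
    using that by (simp add: vs_def)
  have "inj_on F {0..<2 * p}"
  proof (rule inj_onI)
    fix i j assume ij: "i \<in> {0..<2 * p}" "j \<in> {0..<2 * p}" "F i = F j"
    have d: "i div 2 < p" "j div 2 < p" using ij by auto
    have "even i \<longleftrightarrow> even j"
      using ij(3) gwT[of "i div 2" "j div 2"] gwT[of "j div 2" "i div 2"]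
      by (auto simp: F_def split: if_splits)
    moreover from this have "i div 2 = j div 2"
      using ij(3) winj gwinj d by (auto simp: F_def split: if_splits)
    ultimately show "i = j"
      by presburger
  qed
  then have dist: "distinct vs"
    by (simp add: vs_def distinct_map)
  have "adj (vs ! i) (vs ! Suc i)" if i: "Suc i < length vs" for i
  proof (cases "even i")
    case True
    then show ?thesis
      using i len nth g wT by (simp add: F_def)
  next
    case False
    then have "vs ! Suc i = w (Suc (i div 2))" "vs ! i = f (w (Suc (i div 2)))"
      using i len nth gw by (auto simp: F_def)
    then show ?thesis using adjf[OF wT] adj_sym by simp
  qed
  moreover have "adj (last vs) (hd vs)"
  proof -
    have ne: "vs \<noteq> []" using len p2 by auto
    have "odd (2 * p - 1)" "(2 * p - 1) div 2 = p - 1"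
      using p2 by presburger+
    then have "last vs = g (w (p - 1))"
      using ne len nth[of "2 * p - 1"] p2 by (simp add: last_conv_nth F_def)
    also have "\<dots> = f (w 0)"
      using gw[of "p - 1"] wp u by simp
    finally have "last vs = f (w 0)" .
    moreover have "hd vs = w 0"
      using ne len nth[of 0] p2 by (simp add: hd_conv_nth F_def)
    ultimately show ?thesis
      using adjf[OF wT] adj_sym by simp
  qed
  ultimately obtain C where "is_cycle_of G C" "verts C = set vs"
    using cycle_of_list[OF dist] len p2 by auto
  then show ?thesis
    using dist len by (intro exI[of _ C]) (simp add: distinct_card)
qed

section \<open>Tight sets\<close>

lemma nbhd_Diff_sub:
  assumes "indep S E" "x \<in> S"
  shows "nbhd G (S - {x}) \<subseteq> nbhd G S"
  using assms indepD by (auto simp: nbhd_iff)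

text \<open>A stable set violating Hall's condition for \<open>S - {x}\<close> satisfies it for
  \<open>S\<close>. Restoring \<open>x\<close> adds at most one neighbour, so \<open>x\<close> is
  that neighbour and equality holds.\<close>

lemma tight_set_if_not_removable:
  assumes S: "S \<in> Psi G" and x: "x \<in> S" and nx: "S - {x} \<notin> Psi G"
  shows "\<exists>T \<subseteq> nbhd G (S - {x}). indep T E \<and> card (nbrs S T) = card T \<and> x \<in> nbrs S T"
proof -
  note s = PsiD[OF S]
  obtain T where T: "T \<subseteq> nbhd G (S - {x})" "indep T E" "card (nbrs (S - {x}) T) < card T"
    using nx s x unfolding Psi_iff by (meson Diff_subset not_le smaller_indep subset_trans)
  have "T \<subseteq> nbhd G S"
    using T nbhd_Diff_sub[OF s(2) x] by blast
  then have ge: "card T \<le> card (nbrs S T)"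
    using s(4) T by blast
  have fin: "finite (nbrs (S - {x}) T)"
    using s(3) by (auto simp: nbrs_def)
  have xin: "x \<in> nbrs S T"
  proof (rule ccontr)
    assume "x \<notin> nbrs S T"
    then have "nbrs S T = nbrs (S - {x}) T"
      by (auto simp: nbrs_def)
    with ge T show False by simp
  qed
  have "card (nbrs S T) \<le> card (insert x (nbrs (S - {x}) T))"
    using fin by (intro card_mono) (auto simp: nbrs_def)
  also have "\<dots> \<le> Suc (card (nbrs (S - {x}) T))"
    by (rule card_insert_le_m1[OF _ , simplified]) simp_all
  finally have "card (nbrs S T) = card T"
    using ge T by linarith
  with T xin show ?thesis by blast
qed

text \<open>The tight set \<open>U\<close> that blocks \<open>s\<close> lies in the neighbourhood of
  \<open>S - {s}\<close>, so it misses \<open>t\<close>. As \<open>s\<close> is already a neighbour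
  of \<open>U\<close>, adding \<open>t\<close> enlarges the set but not its neighbourhood in
  \<open>S\<close>.\<close>

lemma pendant_violator:
  assumes S: "S \<in> Psi G" and t: "t \<in> nbhd G S" "nbrs S {t} = {s}" and ns: "S - {s} \<notin> Psi G"
  shows "\<exists>U \<subseteq> nbhd G (S - {s}). indep U E \<and> card (nbrs S U) = card U \<and> s \<in> nbrs S U \<and>
    t \<notin> U \<and> card (nbrs S (insert t U)) < card (insert t U)"
proof -
  have s: "s \<in> S" using t nbrs_sub by blast
  obtain U where U: "U \<subseteq> nbhd G (S - {s})" "indep U E" "card (nbrs S U) = card U" "s \<in> nbrs S U"
    using tight_set_if_not_removable[OF S s ns] by blast
  have "t \<notin> nbhd G (S - {s})"
    using t(2) adj_sym by (auto simp: nbhd_iff nbrs_def)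
  then have tU: "t \<notin> U" using U by blast
  have "nbrs S (insert t U) = nbrs S {t} \<union> nbrs S U"
    by (auto simp: nbrs_def)
  then have "nbrs S (insert t U) = nbrs S U"
    using U t by auto
  then have "card (nbrs S (insert t U)) < card (insert t U)"
    using U tU finite_nbhd[OF U(1)] by simp
  with U tU show ?thesis by blast
qed

lemma hall_injection:
  assumes S: "S \<subseteq> V" and T: "T \<subseteq> nbhd G S"
    and hall: "\<And>X. X \<subseteq> T \<Longrightarrow> card X \<le> card (nbrs S X)"
  shows "\<exists>f. inj_on f T \<and> (\<forall>t\<in>T. f t \<in> nbrs S {t})"
proof (rule hall_marriage)
  show "finite T" using T by (rule finite_nbhd)
  show "finite (nbrs S {t})" for t
    using S by (meson finite_sub nbrs_sub subset_trans)
qed (use hall in \<open>simp add: nbrs_UN\<close>)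

lemma tight_image:
  assumes "S \<subseteq> V" and "card (nbrs S T) = card T" and "inj_on f T" and "\<And>t. t \<in> T \<Longrightarrow> f t \<in> nbrs S {t}"
  shows "f ` T = nbrs S T"
proof (rule card_subset_eq)
  show "finite (nbrs S T)"
    using assms(1) by (meson finite_sub nbrs_sub subset_trans)
  show "f ` T \<subseteq> nbrs S T"
    using assms(4) by (fastforce simp: nbrs_def)
  show "card (f ` T) = card (nbrs S T)"
    using assms by (simp add: card_image)
qed

text \<open>Hall's theorem matches \<open>T\<close> into \<open>S\<close>, and by tightness the
  partners fill \<open>nbrs S T\<close>. If no vertex of \<open>T\<close> had just one neighbour in
  \<open>S\<close>, each would have a second one among these partners, giving an even cycle.\<close>

lemma tight_pendant:
  assumes odd: "\<And>C. is_cycle_of G C \<Longrightarrow> odd (card (verts C))"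
    and S: "S \<in> Psi G" and T: "T \<subseteq> nbhd G S" "indep T E" "card (nbrs S T) = card T" "T \<noteq> {}"
  shows "\<exists>t\<in>T. \<exists>s. nbrs S {t} = {s}"
proof (rule ccontr)
  assume no: "\<not> ?thesis"
  note s = PsiD[OF S]
  have "card X \<le> card (nbrs S X)" if "X \<subseteq> T" for X
    using s(4)[of X] that T smaller_indep by blast
  then obtain f where f: "inj_on f T" "\<And>t. t \<in> T \<Longrightarrow> f t \<in> nbrs S {t}"
    using hall_injection[OF s(1) T(1)] by blast
  have im: "f ` T = nbrs S T"
    using tight_image[OF s(1) T(3)] f by blast
  have "\<exists>C. is_cycle_of G C \<and> even (card (verts C))"
  proof (rule even_alternating_cycle)
    show "finite T" using T(1) by (rule finite_nbhd)
    show "f ` T \<inter> T = {}"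
      using im T nbhd_sub[of S] nbrs_sub[of S T] by blast
    show "adj t (f t)" if "t \<in> T" for t
      using f(2)[OF that] adj_sym by (auto simp: nbrs_def)
    show "\<exists>s\<in>f ` T. s \<noteq> f t \<and> adj t s" if t: "t \<in> T" for t
    proof -
      have "nbrs S {t} \<noteq> {f t}" using no t by blast
      then obtain s where "s \<in> nbrs S {t}" "s \<noteq> f t"
        using f(2)[OF t] by blast
      then show ?thesis
        unfolding im using t adj_sym by (auto simp: nbrs_def)
    qed
  qed (use f T in auto)
  then show False using odd by blast
qed

end

section \<open>Matchings\<close>

lemma matching_number_facts:
  assumes "finite (edges H)"
  shows "\<exists>M. matching H M \<and> card M = matching_number H"
    and "matching H M \<Longrightarrow> card M \<le> matching_number H"
proof -
  have fin: "finite (card ` {M. matching H M})"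
    by (rule finite_imageI, rule finite_subset[of _ "Pow (edges H)"])
      (use assms in \<open>auto simp: matching_def\<close>)
  have "matching H {}" by (simp add: matching_def)
  then have "matching_number H \<in> card ` {M. matching H M}"
    unfolding matching_number_def using fin by (intro Max_in) auto
  then show "\<exists>M. matching H M \<and> card M = matching_number H" by force
  show "card M \<le> matching_number H" if "matching H M"
    unfolding matching_number_def using fin that by (intro Max_ge) auto
qed

lemma matching_le_cover:
  assumes "finite B" and "pairwise disjnt M" and "\<And>e. e \<in> M \<Longrightarrow> e \<inter> B \<noteq> {}"
  shows "card M \<le> card B"
proof -
  obtain c where c: "\<And>e. e \<in> M \<Longrightarrow> c e \<in> e \<inter> B"
    using bchoice[of M "\<lambda>e x. x \<in> e \<inter> B"] assms(3) by blast
  have "inj_on c M"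
    using assms(2) c unfolding inj_on_def pairwise_def disjnt_def by (metis IntD1 disjoint_iff)
  then show ?thesis
    using c assms(1) by (intro card_inj_on_le[of c]) auto
qed

text \<open>By equality, selecting a cover vertex on each edge is a bijection onto \<open>B\<close>.
  An edge with both ends in \<open>B\<close> would share its unselected end with the edge that
  selects it, against disjointness.\<close>

lemma matching_eq_cover:
  assumes fin: "finite B" and disj: "pairwise disjnt M" and cov: "\<And>e. e \<in> M \<Longrightarrow> e \<inter> B \<noteq> {}"
    and two: "\<And>e. e \<in> M \<Longrightarrow> card e = 2" and eq: "card M = card B"
  shows "\<exists>f. inj_on f B \<and> f ` B \<inter> B = {} \<and> M = (\<lambda>v. {v, f v}) ` B"
proof -
  obtain c where c: "\<And>e. e \<in> M \<Longrightarrow> c e \<in> e \<inter> B"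
    using bchoice[of M "\<lambda>e x. x \<in> e \<inter> B"] cov by blast
  have same: "e = e'" if "e \<in> M" "e' \<in> M" "x \<in> e" "x \<in> e'" for e e' x
    using disj that unfolding pairwise_def disjnt_def by blast
  have inj: "inj_on c M"
    using same c unfolding inj_on_def by (metis IntD1)
  have "c ` M \<subseteq> B" using c by blast
  then have surj: "c ` M = B"
    using fin inj eq by (metis card_image card_subset_eq)
  have "\<exists>w. {v, w} \<in> M \<and> w \<notin> B" if v: "v \<in> B" for v
  proof -
    obtain e where e: "e \<in> M" "c e = v" using surj v by blast
    have ve: "v \<in> e" using c[OF e(1)] e(2) by blast
    then have "card (e - {v}) = 1" using two[OF e(1)] by simp
    then obtain w where "e - {v} = {w}" by (rule card_1_singletonE)
    then have w: "e = {v, w}" "w \<noteq> v" using ve by blast+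
    have "w \<notin> B"
    proof
      assume "w \<in> B"
      then obtain e' where e': "e' \<in> M" "c e' = w" using surj by blast
      have "w \<in> e'" "w \<in> e" using c[OF e'(1)] e'(2) w(1) by auto
      then have "e' = e" using same[OF e'(1) e(1)] by blast
      then show False using e(2) e'(2) w(2) by simp
    qed
    then show ?thesis using e(1) w(1) by metis
  qed
  then obtain f where f: "\<And>v. v \<in> B \<Longrightarrow> {v, f v} \<in> M \<and> f v \<notin> B" by metis
  have "inj_on f B"
  proof (rule inj_onI)
    fix u v assume uv: "u \<in> B" "v \<in> B" "f u = f v"
    then have "{u, f u} = {v, f v}"
      using same[of "{u, f u}" "{v, f v}" "f u"] f[OF uv(1)] f[OF uv(2)] by simp
    then show "u = v" using uv f by (metis doubleton_eq_iff)
  qed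
  moreover have "e \<in> (\<lambda>v. {v, f v}) ` B" if "e \<in> M" for e
  proof -
    have "c e \<in> B" "c e \<in> e" using c[OF that] by auto
    then have "e = {c e, f (c e)}"
      using same[OF that, of "{c e, f (c e)}" "c e"] f[OF \<open>c e \<in> B\<close>] by simp
    with \<open>c e \<in> B\<close> show ?thesis by blast
  qed
  then have "M = (\<lambda>v. {v, f v}) ` B"
    using f by blast
  ultimately show ?thesis using f by blast
qed

lemma matching_of_inj:
  assumes "inj_on f B" and "f ` B \<inter> B = {}"
  shows "pairwise disjnt ((\<lambda>v. {v, f v}) ` B)" and "card ((\<lambda>v. {v, f v}) ` B) = card B"
proof -
  have ne: "f u \<noteq> v" if "u \<in> B" "v \<in> B" for u v
    using assms(2) that by blast
  show "pairwise disjnt ((\<lambda>v. {v, f v}) ` B)"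
  proof (rule pairwise_imageI)
    fix u v assume "u \<in> B" "v \<in> B" "u \<noteq> v"
    then show "disjnt {u, f u} {v, f v}"
      using ne[of u v] ne[of v u] assms(1) by (auto simp: disjnt_def inj_on_def)
  qed
  have "inj_on (\<lambda>v. {v, f v}) B"
    using ne by (intro inj_onI) (metis doubleton_eq_iff)
  then show "card ((\<lambda>v. {v, f v}) ` B) = card B"
    by (rule card_image)
qed

context fin_simple_graph
begin

lemma finite_E: "finite E"
  using simple unfolding simple_graph_def by (meson finite_imp_finite_nsets finite_subset)

lemma card_edge: "e \<in> E \<Longrightarrow> card e = 2"
  using simple by (auto simp: simple_graph_def nsets_def)

text \<open>A matching of \<open>B\<close> into \<open>S\<close> is encoded by the map from each
  vertex of \<open>B\<close> to its partner, so that two matchings can be compared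
  pointwise.\<close>

definition saturates :: "('a \<Rightarrow> 'a) \<Rightarrow> 'a set \<Rightarrow> 'a set \<Rightarrow> bool" where
  "saturates f B S \<longleftrightarrow> inj_on f B \<and> (\<forall>v\<in>B. f v \<in> nbrs S {v})"

lemma edge_meets_cover:
  assumes "indep S E" "e \<in> E" "e \<subseteq> S \<union> B"
  shows "e \<inter> B \<noteq> {}"
proof -
  obtain u v where "e = {u, v}" "adj u v"
    using edgeD[OF assms(2)] assms(2) by (auto simp: adj_def)
  then show ?thesis
    using indepD[OF assms(1)] assms(3) by auto
qed

text \<open>Stability of \<open>S\<close> makes \<open>B\<close> a vertex cover of the edges inside
  \<open>S \<union> B\<close>; a matching as large as this cover has to match all of
  \<open>B\<close> into \<open>S\<close>.\<close>

lemma matching_saturates: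
  assumes S: "indep S E" and B: "finite B" "S \<inter> B = {}"
    and M: "M \<subseteq> E" "pairwise disjnt M" "\<And>e. e \<in> M \<Longrightarrow> e \<subseteq> S \<union> B"
  shows "card M \<le> card B"
    and "card M = card B \<Longrightarrow> \<exists>f. saturates f B S \<and> M = (\<lambda>v. {v, f v}) ` B"
proof -
  have cov: "e \<inter> B \<noteq> {}" if "e \<in> M" for e
    using edge_meets_cover[OF S] M that by blast
  show "card M \<le> card B"
    using matching_le_cover[OF B(1) M(2) cov] .
  assume eq: "card M = card B"
  have "card e = 2" if "e \<in> M" for e
    using card_edge M that by blast
  then obtain f where f: "inj_on f B" "f ` B \<inter> B = {}" "M = (\<lambda>v. {v, f v}) ` B"
    using matching_eq_cover[OF B(1) M(2) cov _ eq] by auto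
  have "f v \<in> nbrs S {v}" if v: "v \<in> B" for v
  proof -
    have e: "{v, f v} \<in> M" using f v by blast
    then have "f v \<in> S" using M(3)[OF e] f(2) v by blast
    moreover have "adj (f v) v" using e M(1) by (auto simp: adj_def insert_commute)
    ultimately show ?thesis by (simp add: nbrs_def)
  qed
  with f show "\<exists>f. saturates f B S \<and> M = (\<lambda>v. {v, f v}) ` B"
    by (auto simp: saturates_def)
qed

lemma saturates_matching:
  assumes "saturates f B S" and "S \<inter> B = {}"
  shows "(\<lambda>v. {v, f v}) ` B \<subseteq> E" "pairwise disjnt ((\<lambda>v. {v, f v}) ` B)"
    "card ((\<lambda>v. {v, f v}) ` B) = card B"
proof -
  have f: "inj_on f B" "f ` B \<inter> B = {}"
    using assms nbrs_sub by (auto simp: saturates_def nbrs_def)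
  show "(\<lambda>v. {v, f v}) ` B \<subseteq> E"
    using assms adj_sym by (auto simp: saturates_def nbrs_def adj_def insert_commute)
  show "pairwise disjnt ((\<lambda>v. {v, f v}) ` B)" "card ((\<lambda>v. {v, f v}) ` B) = card B"
    using matching_of_inj[OF f] by auto
qed

lemma hall_local_iff_saturates:
  assumes "S \<subseteq> V"
  shows "hall_local S \<longleftrightarrow> (\<exists>f. saturates f (nbhd G S) S)"
proof
  assume "hall_local S"
  then show "\<exists>f. saturates f (nbhd G S) S"
    using hall_injection[OF assms, of "nbhd G S"] by (auto simp: hall_local_def saturates_def)
next
  assume "\<exists>f. saturates f (nbhd G S) S"
  then obtain f where f: "saturates f (nbhd G S) S" by blast
  have "card T \<le> card (nbrs S T)" if "T \<subseteq> nbhd G S" for T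
  proof (rule card_inj_on_le)
    show "inj_on f T"
      using f that by (auto simp: saturates_def intro: inj_on_subset)
    show "f ` T \<subseteq> nbrs S T"
      using f that by (fastforce simp: saturates_def nbrs_def)
    show "finite (nbrs S T)"
      using assms by (meson finite_sub nbrs_sub subset_trans)
  qed
  then show "hall_local S" by (simp add: hall_local_def)
qed

text \<open>The stability number of G[N[S]] is the size of \<open>S\<close>, so the equation says
  that some matching has as many edges as N(S) has vertices, that is, N(S) can be matched into
  \<open>S\<close>.\<close>

lemma konig_egervary_iff:
  assumes S: "S \<in> Psi G"
  shows "konig_egervary (induced G (closed_nbhd G S)) \<longleftrightarrow> hall_local S"
proof -
  let ?H = "induced G (closed_nbhd G S)" and ?B = "nbhd G S"
  note s = PsiD[OF S]
  have B: "finite ?B" "S \<inter> ?B = {}"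
    using finite_nbhd nbhd_sub by blast+
  have eH: "edges ?H = {e \<in> E. e \<subseteq> S \<union> ?B}"
    by (simp add: induced_def closed_nbhd_def)
  have finH: "finite (edges ?H)"
    using finite_E by (simp add: eH)
  have alpha: "stability_number ?H = card S"
    using S by (simp add: Psi_def Omega_def)
  have "card (verts ?H) = card S + card ?B"
    using s(3) B by (simp add: closed_nbhd_def card_Un_disjoint)
  then have KE: "konig_egervary ?H \<longleftrightarrow> matching_number ?H = card ?B"
    by (simp add: konig_egervary_def alpha)
  have HM: "card M \<le> card ?B \<and>
      (card M = card ?B \<longrightarrow> (\<exists>f. saturates f ?B S \<and> M = (\<lambda>v. {v, f v}) ` ?B))"
    if "matching ?H M" for M
    using matching_saturates[OF s(2) B, of M] that by (auto simp: matching_def eH)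
  obtain M where M: "matching ?H M" "card M = matching_number ?H"
    using matching_number_facts(1)[OF finH] by blast
  show ?thesis
  proof
    assume "konig_egervary ?H"
    then show "hall_local S"
      using HM[OF M(1)] M(2) KE hall_local_iff_saturates[OF s(1)] by auto
  next
    assume "hall_local S"
    then obtain f where f: "saturates f ?B S"
      using hall_local_iff_saturates[OF s(1)] by blast
    have "{v, f v} \<subseteq> S \<union> ?B" if "v \<in> ?B" for v
      using f that nbrs_sub by (auto simp: saturates_def nbrs_def)
    then have "matching ?H ((\<lambda>v. {v, f v}) ` ?B)"
      using saturates_matching[OF f B(2)] by (auto simp: matching_def eH)
    then have "card ?B \<le> matching_number ?H"
      using matching_number_facts(2)[OF finH] saturates_matching(3)[OF f B(2)] by metis
    then show "konig_egervary ?H"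
      using HM[OF M(1)] M(2) KE by simp
  qed
qed

section \<open>Accessibility\<close>

text \<open>A blocked \<open>S\<close> has a tight set, which without even cycles contains a vertex
  with one neighbour in \<open>S\<close>. Then \<open>pendant_violator\<close> contradicts Hall's
  condition.\<close>

lemma accessible_if_hall_local:
  assumes odd: "\<And>C. is_cycle_of G C \<Longrightarrow> odd (card (verts C))"
    and hall: "\<And>S. S \<in> Psi G \<Longrightarrow> hall_local S"
  shows accessible
  unfolding accessible_def
proof (intro ballI impI, rule ccontr)
  fix S assume S: "S \<in> Psi G" "S \<noteq> {}" and no: "\<not> (\<exists>x\<in>S. S - {x} \<in> Psi G)"
  note s = PsiD[OF S(1)]
  obtain x where x: "x \<in> S" using S by blast
  obtain T where T: "T \<subseteq> nbhd G (S - {x})" "indep T E" "card (nbrs S T) = card T" "x \<in> nbrs S T"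
    using tight_set_if_not_removable[OF S(1) x] no x by blast
  have TS: "T \<subseteq> nbhd G S"
    using T nbhd_Diff_sub[OF s(2) x] by blast
  moreover have "T \<noteq> {}" using T(4) by (auto simp: nbrs_def)
  ultimately obtain t y where t: "t \<in> T" "nbrs S {t} = {y}"
    using tight_pendant[OF odd S(1) _ T(2,3)] by blast
  have y: "y \<in> S" using t nbrs_sub by blast
  obtain U where U: "U \<subseteq> nbhd G (S - {y})" "card (nbrs S (insert t U)) < card (insert t U)"
    using pendant_violator[OF S(1) _ t(2)] t(1) TS no y by blast
  then have "insert t U \<subseteq> nbhd G S"
    using nbhd_Diff_sub[OF s(2) y] t TS by blast
  then show False
    using hall[OF S(1)] U by (auto simp: hall_local_def not_less[symmetric])
qed

text \<open>The odd alternating cycle through \<open>insert t U\<close> is a triangle. Its edge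
  inside N(S) uses \<open>t\<close>, because \<open>U\<close> is stable, and its vertex in
  \<open>S\<close> is therefore \<open>s\<close>. The third vertex \<open>u\<close> is in
  \<open>U\<close>, so it also has a neighbour in \<open>S - {s}\<close>.\<close>

lemma triangle_at_pendant:
  assumes tri: "\<And>C. is_cycle_of G C \<Longrightarrow> verts C = X" and X: "card X = 3"
    and S: "S \<in> Psi G" and t: "t \<in> nbhd G S" "nbrs S {t} = {s}" and ns: "S - {s} \<notin> Psi G"
  shows "\<exists>U u. U \<subseteq> nbhd G S \<and> indep U E \<and> card (nbrs S U) = card U \<and> t \<notin> U \<and> u \<in> U \<and>
    (\<nexists>y. nbrs S {u} = {y}) \<and> X = {t, s, u}"
proof -
  have s: "s \<in> S" using t nbrs_sub by blast
  obtain U where U: "U \<subseteq> nbhd G (S - {s})" "indep U E" "card (nbrs S U) = card U" "t \<notin> U"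
    "card (nbrs S (insert t U)) < card (insert t U)"
    using pendant_violator[OF S t ns] by blast
  have US: "U \<subseteq> nbhd G S"
    using U nbhd_Diff_sub[OF PsiD(2)[OF S] s] by blast
  then have "insert t U \<subseteq> nbhd G S" using t by blast
  from odd_alternating_cycle[OF S this U(5)] obtain vs where vs: "distinct vs" "3 \<le> length vs"
    and mem: "\<And>i. i < length vs \<Longrightarrow> vs ! i \<in> (if even i then insert t U else S)"
    and step: "\<And>i. Suc i < length vs \<Longrightarrow> adj (vs ! i) (vs ! Suc i)"
    and close: "adj (last vs) (hd vs)" by blast
  obtain C where "is_cycle_of G C" "verts C = set vs"
    using cycle_of_list[OF vs step close] by blast
  then have Xvs: "X = set vs" using tri by blast
  then have "length vs = 3" using X vs by (simp add: distinct_card)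
  then obtain a b c where abc: "vs = [a, b, c]"
    by (auto simp: length_Suc_conv numeral_eq_Suc)
  have m: "a \<in> insert t U" "b \<in> S" "c \<in> insert t U" "adj a b" "adj b c" "adj c a" "a \<noteq> c"
    using mem[of 0] mem[of 1] mem[of 2] step[of 0] step[of 1] close vs(1) abc by auto
  have "\<not> (a \<in> U \<and> c \<in> U)" using m indepD[OF U(2)] by blast
  then obtain u where u: "u \<in> U" "X = {t, b, u}" "adj t b" "adj b u"
    using m Xvs abc adj_sym by (auto simp: insert_commute)
  then have "b \<in> nbrs S {t}" using m adj_sym by (auto simp: nbrs_def)
  then have b: "b = s" using t by simp
  obtain y where "y \<in> S - {s}" "adj y u"
    using u U(1) nbhd_iff by blast
  then have "s \<in> nbrs S {u}" "y \<in> nbrs S {u}" "y \<noteq> s"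
    using u b m by (auto simp: nbrs_def)
  then have "\<nexists>z. nbrs S {u} = {z}" by auto
  with U US u b show ?thesis by blast
qed

text \<open>A first vertex \<open>t\<close> with single neighbour \<open>y\<close> determines the
  triangle \<open>{t, y, u}\<close> and a tight set \<open>U\<close> without \<open>t\<close>. A
  second such vertex \<open>t'\<close>, found in \<open>U\<close>, also lies on the triangle; but it
  is not \<open>t\<close>, not \<open>y\<close>, which is in \<open>S\<close>, and not
  \<open>u\<close>, which has several neighbours in \<open>S\<close>.\<close>

lemma accessible_if_triangle:
  assumes tri: "\<And>C. is_cycle_of G C \<Longrightarrow> verts C = X" and X: "card X = 3"
  shows accessible
  unfolding accessible_def
proof (intro ballI impI, rule ccontr)
  fix S assume S: "S \<in> Psi G" "S \<noteq> {}" and no: "\<not> (\<exists>x\<in>S. S - {x} \<in> Psi G)"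
  note s = PsiD[OF S(1)]
  have odd: "odd (card (verts C))" if "is_cycle_of G C" for C
    using tri[OF that] X by simp
  have ns: "S - {y} \<notin> Psi G" if "nbrs S {t} = {y}" for t y
    using that no nbrs_sub[of S "{t}"] by auto
  obtain x where x: "x \<in> S" using S by blast
  obtain T where T: "T \<subseteq> nbhd G (S - {x})" "indep T E" "card (nbrs S T) = card T" "x \<in> nbrs S T"
    using tight_set_if_not_removable[OF S(1) x] no x by blast
  have TS: "T \<subseteq> nbhd G S"
    using T nbhd_Diff_sub[OF s(2) x] by blast
  moreover have "T \<noteq> {}" using T(4) by (auto simp: nbrs_def)
  ultimately obtain t y where t: "t \<in> T" "nbrs S {t} = {y}"
    using tight_pendant[OF odd S(1) _ T(2,3)] by blast
  then have tS: "t \<in> nbhd G S" using TS by blast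
  obtain U u where U: "U \<subseteq> nbhd G S" "indep U E" "card (nbrs S U) = card U" "t \<notin> U" "u \<in> U"
    "\<nexists>y. nbrs S {u} = {y}" "X = {t, y, u}"
    using triangle_at_pendant[OF tri X S(1) tS t(2) ns[OF t(2)]] by blast
  obtain t' y' where t': "t' \<in> U" "nbrs S {t'} = {y'}"
    using tight_pendant[OF odd S(1) U(1-3)] U(5) by blast
  then have "t' \<in> nbhd G S" using U by blast
  from triangle_at_pendant[OF tri X S(1) this t'(2) ns[OF t'(2)]]
  have "t' \<in> X" by blast
  moreover have "t' \<noteq> u" using t' U by blast
  moreover have "t' \<noteq> y"
    using t' t U(1) nbhd_sub nbrs_sub by blast
  ultimately show False using U t' by blast
qed

text \<open>Induction along accessible removals: deleting \<open>x\<close> loses at most one vertex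
  of N(S), and \<open>x\<close> itself pays for that vertex.\<close>

lemma hall_local_if_accessible:
  assumes acc: accessible and tf: "\<And>C. is_cycle_of G C \<Longrightarrow> card (verts C) \<noteq> 3"
    and "S \<in> Psi G"
  shows "hall_local S"
  using assms(3)
proof (induction "card S" arbitrary: S rule: less_induct)
  case less
  note S = less.prems and s = PsiD[OF less.prems]
  show ?case
  proof (cases "S = {}")
    case True
    then show ?thesis by (auto simp: hall_local_def nbhd_def)
  next
    case False
    then obtain x where x: "x \<in> S" "S - {x} \<in> Psi G"
      using acc S by (auto simp: accessible_def)
    have "card (S - {x}) < card S" using x s(3) by (metis card_Diff1_less)
    then have IH: "hall_local (S - {x})" using less.hyps x by blast
    \<comment> \<open>Two lost vertices would have \<open>x\<close> as their only neighbour in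
      \<open>S\<close>. If nonadjacent, they violate Hall's condition; if adjacent, they form a
      triangle with \<open>x\<close>.\<close>
    have one: "a = b" if "a \<in> nbhd G S - nbhd G (S - {x})" "b \<in> nbhd G S - nbhd G (S - {x})" for a b
    proof (rule ccontr)
      assume ne: "a \<noteq> b"
      have ab: "nbrs S {a} = {x}" "nbrs S {b} = {x}"
        using that x(1) by (auto simp: nbhd_iff nbrs_def)
      then have "nbrs S {a, b} = {x}"
        by (auto simp: nbrs_def)
      then have "\<not> indep {a, b} E"
        using s(4)[of "{a, b}"] that ne by auto
      then have "adj a b"
        using indepI[of "{a, b}"] adjD(1) adj_sym by blast
      moreover have "adj x a" "adj x b" using ab by (auto simp: nbrs_def)
      ultimately have "\<exists>C. is_cycle_of G C \<and> verts C = set [x, a, b]"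
        using ne adjD(1)[of x a] adjD(1)[of x b] adj_sym
        by (intro cycle_of_list) (auto simp: less_Suc_eq)
      then obtain C where "is_cycle_of G C" "verts C = {x, a, b}" by auto
      moreover have "card {x, a, b} = 3"
        using ne adjD(1)[of x a] adjD(1)[of x b] \<open>adj x a\<close> \<open>adj x b\<close> by auto
      ultimately show False using tf by metis
    qed
    have "card T \<le> card (nbrs S T)" if T: "T \<subseteq> nbhd G S" for T
    proof -
      let ?A = "T \<inter> nbhd G (S - {x})" and ?N = "T - nbhd G (S - {x})"
      have A: "card ?A \<le> card (nbrs (S - {x}) ?A)"
        using IH by (auto simp: hall_local_def)
      have finT: "finite T" using T by (rule finite_nbhd)
      have finN: "finite (nbrs S T)" using s(3) by (auto simp: nbrs_def)
      have cT: "card T = card ?A + card ?N"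
        using finT by (metis Int_Diff_Un Int_Diff_disjoint card_Un_disjoint finite_Diff finite_Int)
      show ?thesis
      proof (cases "?N = {}")
        case True
        have "card (nbrs (S - {x}) ?A) \<le> card (nbrs S T)"
          using finN by (intro card_mono) (auto simp: nbrs_def)
        then show ?thesis using A cT True by simp
      next
        case False
        then obtain a where a: "a \<in> ?N" by blast
        then have "?N = {a}" using one T by blast
        then have "card ?N = 1" by simp
        moreover have "adj x a"
          using a subsetD[OF T, of a] x by (auto simp: nbhd_iff)
        then have "insert x (nbrs (S - {x}) ?A) \<subseteq> nbrs S T"
          using x a by (auto simp: nbrs_def)
        then have "card (insert x (nbrs (S - {x}) ?A)) \<le> card (nbrs S T)"
          using finN by (rule card_mono[rotated])
        moreover have "card (insert x (nbrs (S - {x}) ?A)) = Suc (card (nbrs (S - {x}) ?A))"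
          using s(3) by (subst card_insert_disjoint) (auto simp: nbrs_def)
        ultimately show ?thesis using A cT by linarith
      qed
    qed
    then show ?thesis by (simp add: hall_local_def)
  qed
qed

end

section \<open>Uniquely restricted maximum matchings\<close>

context fin_simple_graph
begin

section \<open>Maximum stable sets of the whole graph and their matchings\<close>

lemma Omega_G_iff:
  "S \<in> Omega G \<longleftrightarrow> S \<subseteq> V \<and> indep S E \<and> (\<forall>T \<subseteq> V. indep T E \<longrightarrow> card T \<le> card S)"
  by (auto simp: Omega_iff[OF finite_V] stable_set_def)

lemma Omega_nonempty: "\<exists>S. S \<in> Omega G"
proof -
  have "\<exists>S. (S \<subseteq> V \<and> indep S E) \<and> (\<forall>T. T \<subseteq> V \<and> indep T E \<longrightarrow> card T \<le> card S)"
    using card_mono[OF finite_V]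
    by (intro ex_has_greatest_nat[where k = "{}" and b = "Suc (card V)"]) (auto simp: less_Suc_eq_le)
  then show ?thesis by (auto simp: Omega_G_iff)
qed

lemma Psi_card_le:
  assumes "S \<in> Psi G" "T \<subseteq> closed_nbhd G S" "indep T E"
  shows "card T \<le> card S"
  using assms finite_sub[OF closed_nbhd_sub[OF PsiD(1)[OF assms(1)]]]
  by (auto simp: Psi_def Omega_iff stable_induced)

lemma Omega_sub_Psi:
  assumes "S \<in> Omega G"
  shows "S \<in> Psi G"
proof -
  have S: "S \<subseteq> V" "indep S E" "\<And>T. T \<subseteq> V \<Longrightarrow> indep T E \<Longrightarrow> card T \<le> card S"
    using assms by (auto simp: Omega_G_iff)
  have N: "closed_nbhd G S \<subseteq> V" "S \<subseteq> closed_nbhd G S"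
    using closed_nbhd_sub[OF S(1)] by (auto simp: closed_nbhd_def)
  then have "\<forall>T. T \<subseteq> closed_nbhd G S \<and> indep T E \<longrightarrow> card T \<le> card S"
    using S(3) by blast
  then show ?thesis
    using S(1,2) N finite_sub[OF N(1)] by (simp add: Psi_def Omega_iff stable_induced)
qed

lemma Omega_nbhd:
  assumes "S \<in> Omega G"
  shows "nbhd G S = V - S"
proof
  show "nbhd G S \<subseteq> V - S" by (rule nbhd_sub)
  show "V - S \<subseteq> nbhd G S"
  proof (rule ccontr)
    assume "\<not> V - S \<subseteq> nbhd G S"
    then obtain v where v: "v \<in> V" "v \<notin> S" "v \<notin> nbhd G S" by blast
    have S: "S \<subseteq> V" "indep S E" using assms by (auto simp: Omega_G_iff)
    have "indep (insert v S) E"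
      using v indepD[OF S(2)] adj_sym adjD(1)[of v v] by (intro indepI) (auto simp: nbhd_iff)
    then have "card (insert v S) \<le> card S"
      using assms S v by (auto simp: Omega_G_iff)
    then show False
      using v finite_sub[OF S(1)] by simp
  qed
qed

text \<open>The Nemhauser-Trotter extension property. Within \<open>closed_nbhd G S\<close>, a
  maximum stable set \<open>X\<close> has at most as many vertices as \<open>S\<close>, so
  exchanging that part of \<open>X\<close> for \<open>S\<close> loses nothing.\<close>

lemma Psi_extend_Omega:
  assumes S: "S \<in> Psi G"
  shows "\<exists>S'\<in>Omega G. S \<subseteq> S'"
proof -
  obtain X where X: "X \<in> Omega G" using Omega_nonempty by blast
  let ?Z = "S \<union> (X - closed_nbhd G S)"
  have Z: "?Z \<in> Psi G" using Psi_extend[OF Omega_sub_Psi[OF X] S] .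
  note x = PsiD[OF Omega_sub_Psi[OF X]] and s = PsiD[OF S]
  have "card X = card (X \<inter> closed_nbhd G S) + card (X - closed_nbhd G S)"
    using x(3) by (metis Int_Diff_Un Int_Diff_disjoint card_Un_disjoint finite_Diff finite_Int)
  also have "\<dots> \<le> card S + card (X - closed_nbhd G S)"
    using Psi_card_le[OF S _ smaller_indep[OF x(2)]] by simp
  also have "\<dots> = card ?Z"
    using s(3) x(3) by (intro card_Un_disjoint[symmetric]) (auto simp: closed_nbhd_def)
  finally have "?Z \<in> Omega G"
    using X PsiD[OF Z] unfolding Omega_G_iff by (meson order_trans)
  then show ?thesis by blast
qed

text \<open>\<open>V - S\<close> is a vertex cover and bounds the size of every matching. Hall's
  condition attains the bound, so the maximum matchings are those with equality.\<close>

lemma maximum_matching_iff: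
  assumes S: "S \<in> Omega G" and hall: "hall_local S"
  shows "maximum_matching G M \<longleftrightarrow>
    (\<exists>f. saturates f (V - S) S \<and> M = (\<lambda>v. {v, f v}) ` (V - S))"
proof -
  have s: "S \<subseteq> V" "indep S E" using S by (auto simp: Omega_G_iff)
  have B: "finite (V - S)" "S \<inter> (V - S) = {}" using finite_V by auto
  have eV: "e \<subseteq> S \<union> (V - S)" if "e \<in> E" for e
    using edgeD[OF that] s by auto
  obtain f0 where f0: "saturates f0 (V - S) S"
    using hall hall_local_iff_saturates[OF s(1)] Omega_nbhd[OF S] by auto
  have le: "card N \<le> card (V - S)" if "matching G N" for N
    using matching_saturates(1)[OF s(2) B] that eV by (auto simp: matching_def)
  have sat: "matching G ((\<lambda>v. {v, f v}) ` (V - S))" "card ((\<lambda>v. {v, f v}) ` (V - S)) = card (V - S)"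
    if "saturates f (V - S) S" for f
    using saturates_matching[OF that B(2)] by (auto simp: matching_def)
  have mu: "matching_number G = card (V - S)"
  proof (rule antisym)
    show "matching_number G \<le> card (V - S)"
      using matching_number_facts(1)[OF finite_E] le by metis
    show "card (V - S) \<le> matching_number G"
      using matching_number_facts(2)[OF finite_E] sat[OF f0] by metis
  qed
  show ?thesis
  proof
    assume "maximum_matching G M"
    then have M: "M \<subseteq> E" "pairwise disjnt M" "card M = card (V - S)"
      by (auto simp: maximum_matching_def matching_def mu)
    show "\<exists>f. saturates f (V - S) S \<and> M = (\<lambda>v. {v, f v}) ` (V - S)"
      using matching_saturates(2)[OF s(2) B M(1,2) _ M(3)] eV M(1) by blast
  next
    assume "\<exists>f. saturates f (V - S) S \<and> M = (\<lambda>v. {v, f v}) ` (V - S)"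
    then show "maximum_matching G M"
      using sat mu by (auto simp: maximum_matching_def)
  qed
qed

text \<open>Minimality of the tight set keeps Hall's condition valid after the deletion of one edge.\<close>

lemma rematch_minimal_tight:
  assumes S: "S \<subseteq> V" and T: "T \<subseteq> nbhd G S" "card (nbrs S T) = card T"
    and hall: "hall_local S"
    and least: "\<And>X. X \<subset> T \<Longrightarrow> X \<noteq> {} \<Longrightarrow> card (nbrs S X) \<noteq> card X"
    and v: "v \<in> T" "T \<noteq> {v}"
  shows "\<exists>g. saturates g T S \<and> g v \<noteq> s"
proof -
  define N where "N t = (if t = v then nbrs S {t} - {s} else nbrs S {t})" for t
  have finT: "finite T" using T(1) by (rule finite_nbhd)
  have finS: "finite (nbrs S X)" for X
    using S by (meson finite_sub nbrs_sub subset_trans)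
  have strict: "card X < card (nbrs S X)" if "X \<subset> T" "X \<noteq> {}" for X
    using least[OF that] hall that T(1) unfolding hall_local_def
    by (metis le_neq_implies_less order_trans psubset_imp_subset)
  have "\<exists>g. inj_on g T \<and> (\<forall>t\<in>T. g t \<in> N t)"
  proof (rule hall_marriage[OF finT])
    show "finite (N t)" for t using finS by (auto simp: N_def)
    then have finU: "finite (\<Union>(N ` X))" if "X \<subseteq> T" for X
      using that finT by (meson finite_UN finite_subset)
    show "card X \<le> card (\<Union>(N ` X))" if X: "X \<subseteq> T" for X
    proof (cases "v \<in> X")
      case False
      then have "N t = nbrs S {t}" if "t \<in> X" for t
        using that by (auto simp: N_def)
      then have "\<Union>(N ` X) = nbrs S X" by (simp add: nbrs_UN)
      then show ?thesis using hall X T by (simp add: hall_local_def)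
    next
      case vX: True
      show ?thesis
      proof (cases "X = T")
        case True
        have "card T = Suc (card (T - {v}))"
          using finT v by (metis card.remove)
        also have "\<dots> \<le> card (nbrs S (T - {v}))"
          using strict[of "T - {v}"] v by (auto simp: Suc_le_eq)
        also have "\<dots> \<le> card (\<Union>(N ` X))"
          using finU[OF X] True by (intro card_mono) (auto simp: N_def nbrs_def)
        finally show ?thesis using True by simp
      next
        case False
        then have "Suc (card X) \<le> card (nbrs S X)"
          using strict[of X] X vX by (auto simp: Suc_le_eq)
        moreover have "card (nbrs S X) - 1 \<le> card (nbrs S X - {s})"
          by (metis card_Diff_singleton_if diff_le_self order_refl)
        moreover have "card (nbrs S X - {s}) \<le> card (\<Union>(N ` X))"
          using finU[OF X] by (intro card_mono) (auto simp: N_def nbrs_def)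
        ultimately show ?thesis by linarith
      qed
    qed
  qed
  then obtain g where g: "inj_on g T" "\<And>t. t \<in> T \<Longrightarrow> g t \<in> N t" by blast
  have "g v \<noteq> s" using g(2)[OF v(1)] by (auto simp: N_def)
  moreover have "saturates g T S"
    using g by (metis DiffD1 N_def saturates_def)
  ultimately show ?thesis by blast
qed

text \<open>For a blocked \<open>S\<close> every vertex of N(S) has several neighbours in
  \<open>S\<close>. A minimal tight set then has at least two vertices and two different matchings
  into \<open>S\<close>, which extend to maximum matchings of the graph with the same saturated
  vertices.\<close>

lemma accessible_if_uniquely_restricted:
  assumes hall: "\<And>S. S \<in> Psi G \<Longrightarrow> hall_local S"
    and ur: "\<And>M. maximum_matching G M \<Longrightarrow> uniquely_restricted G M"
  shows accessible
  unfolding accessible_def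
proof (intro ballI impI, rule ccontr)
  fix S assume S: "S \<in> Psi G" "S \<noteq> {}" and no: "\<not> (\<exists>x\<in>S. S - {x} \<in> Psi G)"
  note s = PsiD[OF S(1)]
  have not_pendant: "nbrs S {t} \<noteq> {y}" if t: "t \<in> nbhd G S" for t y
  proof
    assume y: "nbrs S {t} = {y}"
    then have yS: "y \<in> S" using nbrs_sub by blast
    then obtain U where U: "U \<subseteq> nbhd G (S - {y})" "card (nbrs S (insert t U)) < card (insert t U)"
      using pendant_violator[OF S(1) t y] no by blast
    then have "insert t U \<subseteq> nbhd G S"
      using nbhd_Diff_sub[OF s(2) yS] t by blast
    then show False
      using hall[OF S(1)] U by (auto simp: hall_local_def not_less[symmetric])
  qed
  let ?P = "\<lambda>T. T \<subseteq> nbhd G S \<and> T \<noteq> {} \<and> card (nbrs S T) = card T"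
  obtain x where x: "x \<in> S" using S by blast
  obtain T0 where T0: "T0 \<subseteq> nbhd G (S - {x})" "card (nbrs S T0) = card T0" "x \<in> nbrs S T0"
    using tight_set_if_not_removable[OF S(1) x] no x by blast
  then have "?P T0"
    using nbhd_Diff_sub[OF s(2) x] by (auto simp: nbrs_def)
  then obtain T where T: "T \<subseteq> nbhd G S" "T \<noteq> {}" "card (nbrs S T) = card T"
    and least: "\<And>X. ?P X \<Longrightarrow> card T \<le> card X"
    using ex_has_least_nat[of ?P T0 card] by blast
  have finT: "finite T" using T(1) by (rule finite_nbhd)
  obtain v where v: "v \<in> T" using T by blast
  have Tv: "T \<noteq> {v}"
  proof
    assume "T = {v}"
    then have "card (nbrs S {v}) = 1" using T by simp
    then show False using not_pendant[of v] v T by (auto simp: card_1_singleton_iff)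
  qed
  have min: "card (nbrs S X) \<noteq> card X" if "X \<subset> T" "X \<noteq> {}" for X
    using least[of X] that T psubset_card_mono[OF finT that(1)] by fastforce
  obtain f where f: "saturates f (nbhd G S) S"
    using hall[OF S(1)] hall_local_iff_saturates[OF s(1)] by blast
  obtain g where g: "saturates g T S" "g v \<noteq> f v"
    using rematch_minimal_tight[OF s(1) T(1,3) hall[OF S(1)] min v Tv] by blast
  obtain S' where S': "S' \<in> Omega G" "S \<subseteq> S'" using Psi_extend_Omega[OF S(1)] by blast
  let ?B = "V - S'"
  have s': "S' \<subseteq> V" "indep S' E" using S' by (auto simp: Omega_G_iff)
  have nb: "nbhd G S \<subseteq> ?B"
    using indepD[OF s'(2) subsetD[OF S'(2)]] adjD(3) by (auto simp: nbhd_iff)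
  have hall': "hall_local S'" using hall Omega_sub_Psi S' by blast
  obtain f' where f': "saturates f' ?B S'"
    using hall' hall_local_iff_saturates[OF s'(1)] Omega_nbhd[OF S'(1)] by auto
  \<comment> \<open>A vertex outside N(S) has no neighbour in \<open>S\<close>, so its partner under
    \<open>f'\<close> is never a partner under \<open>f\<close>, and the two maps combine
    injectively.\<close>
  have out: "f' w \<in> S' - S" if "w \<in> ?B - nbhd G S" for w
    using f' that S'(2) by (auto simp: saturates_def nbrs_def nbhd_iff)
  define F where "F w = (if w \<in> nbhd G S then f w else f' w)" for w
  define F' where "F' w = (if w \<in> T then g w else F w)" for w
  have fS: "f w \<in> S" "adj (f w) w" if "w \<in> nbhd G S" for w
    using f that by (auto simp: saturates_def nbrs_def)
  have F: "saturates F ?B S'"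
  proof -
    have "inj_on F ?B"
    proof (rule inj_onI)
      fix a b assume ab: "a \<in> ?B" "b \<in> ?B" "F a = F b"
      then have "a \<in> nbhd G S \<longleftrightarrow> b \<in> nbhd G S"
        using out fS unfolding F_def by (metis DiffD2 DiffI)
      then show "a = b"
        using ab f f' by (auto simp: F_def saturates_def inj_on_def split: if_splits)
    qed
    moreover have "\<forall>w\<in>?B. F w \<in> nbrs S' {w}"
      using f' fS S'(2) by (auto simp: F_def saturates_def nbrs_def)
    ultimately show ?thesis by (simp add: saturates_def)
  qed
  \<comment> \<open>By tightness both matchings send \<open>T\<close> onto \<open>nbrs S T\<close>,
    so exchanging them on \<open>T\<close> keeps injectivity and the saturated vertices.\<close>
  have imf: "F ` T = nbrs S T"
  proof -
    have "F ` T = f ` T" using T(1) by (auto simp: F_def)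
    also have "\<dots> = nbrs S T"
      using f T(1) by (intro tight_image[OF s(1) T(3)]) (auto simp: saturates_def intro: inj_on_subset)
    finally show ?thesis .
  qed
  have img: "F' ` T = nbrs S T"
  proof -
    have "F' ` T = g ` T" by (auto simp: F'_def)
    also have "\<dots> = nbrs S T"
      using g by (intro tight_image[OF s(1) T(3)]) (auto simp: saturates_def)
    finally show ?thesis .
  qed
  have TB: "T \<subseteq> ?B" using T nb by blast
  have F': "saturates F' ?B S'"
  proof -
    have "inj_on F' ?B"
    proof (rule inj_onI)
      fix a b assume ab: "a \<in> ?B" "b \<in> ?B" "F' a = F' b"
      have key: "F' c \<noteq> F' d" if "c \<in> T" "d \<in> ?B - T" for c d
      proof
        assume "F' c = F' d"
        then have "F d \<in> F ` T"
          using that img imf by (metis DiffD2 F'_def imageI)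
        then show False
          using F that TB by (auto simp: saturates_def inj_on_def)
      qed
      then have "a \<in> T \<longleftrightarrow> b \<in> T" using ab by (metis DiffI)
      then show "a = b"
        using ab g F by (auto simp: F'_def saturates_def inj_on_def split: if_splits)
    qed
    moreover have "\<forall>w\<in>?B. F' w \<in> nbrs S' {w}"
      using F g S'(2) by (auto simp: F'_def saturates_def nbrs_def)
    ultimately show ?thesis by (simp add: saturates_def)
  qed
  have imB: "F' ` ?B = F ` ?B"
  proof -
    have "?B = T \<union> (?B - T)" using TB by blast
    then have "F' ` ?B = F' ` T \<union> F' ` (?B - T)" "F ` ?B = F ` T \<union> F ` (?B - T)"
      by (metis image_Un)+
    moreover have "F' ` (?B - T) = F ` (?B - T)" by (auto simp: F'_def)
    ultimately show ?thesis using imf img by simp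
  qed
  let ?M = "(\<lambda>v. {v, F v}) ` ?B" and ?M' = "(\<lambda>v. {v, F' v}) ` ?B"
  have "\<Union>?M = ?B \<union> F ` ?B" "\<Union>?M' = ?B \<union> F' ` ?B" by auto
  then have eqU: "\<Union>?M' = \<Union>?M" using imB by simp
  have "maximum_matching G ?M'"
    using maximum_matching_iff[OF S'(1) hall'] F' by blast
  then have "?M' \<subseteq> E" "pairwise disjnt ?M'"
    by (auto simp: maximum_matching_def matching_def)
  moreover have "e \<subseteq> \<Union>?M" if "e \<in> ?M'" for e
    using eqU that by blast
  ultimately have "perfect_matching (induced G (\<Union>?M)) ?M'"
    unfolding perfect_matching_def matching_def using eqU by (auto simp: induced_def)
  moreover have "uniquely_restricted G ?M"
    using ur maximum_matching_iff[OF S'(1) hall'] F by blast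
  ultimately have "?M' = ?M"
    unfolding uniquely_restricted_def by blast
  moreover have "v \<in> ?B" using v TB by blast
  ultimately obtain w where w: "w \<in> ?B" "{v, F' v} = {w, F w}" by blast
  have "F w \<in> S'" using F w by (auto simp: saturates_def nbrs_def)
  then have "F' v = F v" using w v TB by (auto simp: doubleton_eq_iff)
  then show False using g(2) v T by (auto simp: F'_def F_def)
qed

text \<open>By Hall's condition the neighbourhood of \<open>S - {x}\<close> is too small to be all
  of N(S), so some \<open>w\<close> is lost. Its only neighbour in \<open>S\<close> is
  \<open>x\<close>, which fixes its partner under both maps; no other vertex is lost, and the
  induction continues with \<open>S - {x}\<close>.\<close>

lemma unique_saturating:
  assumes acc: accessible and hall: "\<And>S. S \<in> Psi G \<Longrightarrow> hall_local S"
    and "S \<in> Psi G" and "card (nbhd G S) = card S"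
    and "saturates f (nbhd G S) S" and "saturates g (nbhd G S) S"
    and "v \<in> nbhd G S"
  shows "f v = g v"
  using assms(3-)
proof (induction "card S" arbitrary: S rule: less_induct)
  case less
  note S = less.prems(1) and s = PsiD[OF less.prems(1)] and sat = less.prems(3,4)
  have fin: "finite (nbhd G S)" using finite_nbhd by blast
  have "S \<noteq> {}" using less.prems by (auto simp: nbhd_def)
  then obtain x where x: "x \<in> S" "S - {x} \<in> Psi G"
    using acc S by (auto simp: accessible_def)
  have sub: "nbhd G (S - {x}) \<subseteq> nbhd G S" using nbhd_Diff_sub[OF s(2) x(1)] .
  have lt: "card (S - {x}) < card S" using x s(3) by (metis card_Diff1_less)
  have "card (nbhd G (S - {x})) \<le> card (nbrs (S - {x}) (nbhd G (S - {x})))"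
    using hall[OF x(2)] by (simp add: hall_local_def)
  also have "\<dots> \<le> card (S - {x})"
    using s(3) nbrs_sub by (intro card_mono) auto
  finally have le: "card (nbhd G (S - {x})) \<le> card (S - {x})" .
  then obtain w where w: "w \<in> nbhd G S" "w \<notin> nbhd G (S - {x})"
    using lt less.prems(2) sub by (metis leD subsetI subset_antisym)
  have "y = x" if "y \<in> nbrs S {w}" for y
    using w that by (auto simp: nbhd_iff nbrs_def)
  then have wx: "f w = x" "g w = x"
    using sat w by (auto simp: saturates_def)
  have fg: "f u \<noteq> x" "g u \<noteq> x" if "u \<in> nbhd G S" "u \<noteq> w" for u
    using sat w wx that by (auto simp: saturates_def inj_on_def)
  have eq: "nbhd G (S - {x}) = nbhd G S - {w}"
  proof
    show "nbhd G (S - {x}) \<subseteq> nbhd G S - {w}" using sub w by blast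
    show "nbhd G S - {w} \<subseteq> nbhd G (S - {x})"
    proof
      fix u assume u: "u \<in> nbhd G S - {w}"
      then have "f u \<in> S - {x}" "adj (f u) u"
        using sat(1) fg by (auto simp: saturates_def nbrs_def)
      then show "u \<in> nbhd G (S - {x})"
        using u by (auto simp: nbhd_iff)
    qed
  qed
  show ?case
  proof (cases "v = w")
    case False
    show ?thesis
    proof (rule less.hyps[OF lt x(2)])
      show "card (nbhd G (S - {x})) = card (S - {x})"
        using less.prems(2) w x fin s(3) by (simp add: eq)
      show "saturates f (nbhd G (S - {x})) (S - {x})" "saturates g (nbhd G (S - {x})) (S - {x})"
        using sat fg by (auto simp: saturates_def eq nbrs_def intro: inj_on_subset)
      show "v \<in> nbhd G (S - {x})" using less.prems False by (simp add: eq)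
    qed
  qed (simp add: wx)
qed

text \<open>Two perfect matchings on the same vertices have equal size, so both are maximum and come
  from maps \<open>f\<close> and \<open>g\<close> into a maximum stable set. Their difference set
  \<open>D\<close> is enclosed in the neighbourhood of a tight set in \<open>Psi G\<close>, where
  \<open>unique_saturating\<close> makes them agree.\<close>

lemma uniquely_restricted_if_accessible:
  assumes acc: accessible and hall: "\<And>S. S \<in> Psi G \<Longrightarrow> hall_local S"
    and max: "maximum_matching G M"
  shows "uniquely_restricted G M"
proof -
  have M: "M \<subseteq> E" "pairwise disjnt M" "matching G M"
    using max by (auto simp: maximum_matching_def matching_def)
  have perf: "perfect_matching (induced G (\<Union>M)) M"
    using M by (auto simp: perfect_matching_def matching_def induced_def)
  have "M' = M" if M': "perfect_matching (induced G (\<Union>M)) M'" for M'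
  proof -
    have m': "M' \<subseteq> E" "pairwise disjnt M'" "\<Union>M' = \<Union>M"
      using M' by (auto simp: perfect_matching_def matching_def induced_def)
    have two: "card (\<Union>N) = 2 * card N" if N: "N \<subseteq> E" "pairwise disjnt N" for N
    proof -
      have "finite e" if "e \<in> N" for e
        using card_edge N that by (metis card.infinite subsetD zero_neq_numeral)
      then have "card (\<Union>N) = sum card N"
        using N by (intro card_Union_disjoint) auto
      also have "\<dots> = (\<Sum>e\<in>N. 2)"
        using card_edge N by (intro sum.cong) auto
      finally show ?thesis by simp
    qed
    have "card M' = card M"
      using two[of M] two[of M'] M m' by simp
    then have max': "maximum_matching G M'"
      using max m' by (simp add: maximum_matching_def matching_def)
    obtain S where S: "S \<in> Omega G" using Omega_nonempty by blast
    let ?B = "V - S"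
    note s = PsiD[OF Omega_sub_Psi[OF S]]
    have hS: "hall_local S" using hall Omega_sub_Psi S by blast
    obtain f where f: "saturates f ?B S" "M = (\<lambda>v. {v, f v}) ` ?B"
      using max maximum_matching_iff[OF S hS] by blast
    obtain g where g: "saturates g ?B S" "M' = (\<lambda>v. {v, g v}) ` ?B"
      using max' maximum_matching_iff[OF S hS] by blast
    have fS: "f v \<in> S" "adj (f v) v" and gS: "g v \<in> S" "adj (g v) v" if "v \<in> ?B" for v
      using f g that by (auto simp: saturates_def nbrs_def)
    have "f ` ?B = \<Union>M - ?B" "g ` ?B = \<Union>M' - ?B"
      using fS gS unfolding f(2) g(2) by auto
    then have im: "f ` ?B = g ` ?B" using m' by simp
    define D where "D = {v \<in> ?B. f v \<noteq> g v}"
    have gD: "g v \<in> f ` D" if v: "v \<in> D" for v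
    proof -
      obtain w where w: "w \<in> ?B" "g v = f w"
        using im v by (metis (mono_tags, lifting) D_def imageE imageI mem_Collect_eq)
      have "w \<in> D"
      proof (rule ccontr)
        assume "w \<notin> D"
        then have "g v = g w" using w by (simp add: D_def)
        then have "v = w" using g(1) w v by (auto simp: saturates_def inj_on_def D_def)
        then show False using v \<open>w \<notin> D\<close> by simp
      qed
      then show ?thesis using w by blast
    qed
    \<comment> \<open>A candidate \<open>X\<close> contains the partners of \<open>D\<close> and of
      its own neighbours, so \<open>f\<close> matches N(X) into \<open>X\<close>. In a smallest
      candidate every vertex is such a partner, since any other could be dropped; this makes N(X)
      and \<open>X\<close> equally large.\<close>
    define Q where "Q X \<longleftrightarrow> X \<subseteq> S \<and> f ` D \<subseteq> X \<and> f ` nbhd G X \<subseteq> X" for X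
    have "Q S" using fS Omega_nbhd[OF S] by (auto simp: D_def Q_def)
    then obtain X where "Q X" and least: "\<And>Y. Q Y \<Longrightarrow> card X \<le> card Y"
      using ex_has_least_nat[of Q S card] by blast
    then have X: "X \<subseteq> S" "f ` D \<subseteq> X" "f ` nbhd G X \<subseteq> X"
      by (auto simp: Q_def)
    have finX: "finite X" using X(1) s(3) by (rule finite_subset)
    have nb: "nbhd G X \<subseteq> ?B"
      using indepD[OF s(2) subsetD[OF X(1)]] adjD(3) by (auto simp: nbhd_iff)
    have DX: "D \<subseteq> nbhd G X"
    proof
      fix v assume v: "v \<in> D"
      then have "f v \<in> X" "v \<in> ?B" using X by (auto simp: D_def)
      then show "v \<in> nbhd G X" using fS X(1) nbhd_iff by blast
    qed
    have onto: "X \<subseteq> f ` nbhd G X"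
    proof
      fix y assume y: "y \<in> X"
      show "y \<in> f ` nbhd G X"
      proof (rule ccontr)
        assume n: "y \<notin> f ` nbhd G X"
        have "nbhd G (X - {y}) \<subseteq> nbhd G X"
          using nbhd_Diff_sub[OF smaller_indep[OF s(2) X(1)] y] .
        then have "Q (X - {y})" using X n DX unfolding Q_def by blast
        then have "card X \<le> card (X - {y})" by (rule least)
        then show False using y finX by (metis card_Diff1_less leD)
      qed
    qed
    have satf: "saturates f (nbhd G X) X"
      using f(1) nb X(3) by (auto simp: saturates_def nbrs_def intro: inj_on_subset)
    have "g v \<in> X" if "v \<in> nbhd G X" for v
      using gD[of v] X nb that by (cases "v \<in> D") (auto simp: D_def)
    then have satg: "saturates g (nbhd G X) X"
      using g(1) nb by (auto simp: saturates_def nbrs_def intro: inj_on_subset)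
    have "hall_local X"
      using satf hall_local_iff_saturates X(1) s(1) by blast
    then have PX: "X \<in> Psi G"
      using X(1) s smaller_indep unfolding Psi_iff hall_local_def by blast
    have "card (nbhd G X) = card X"
      using satf onto X(3) by (metis card_image saturates_def subset_antisym)
    then have "f v = g v" if "v \<in> nbhd G X" for v
      using unique_saturating[OF acc hall PX _ satf satg that] by blast
    then have "D = {}" using DX by (auto simp: D_def)
    then have "f v = g v" if "v \<in> ?B" for v
      using that by (auto simp: D_def)
    then show "M' = M" using f g by (auto intro!: image_cong)
  qed
  then show ?thesis
    using M perf by (auto simp: uniquely_restricted_def)
qed

end

section \<open>The three cases by the length of the unique cycle\<close>

theorem theorem2p7:
  fixes G C :: "'a graph" and k :: nat
  assumes "simple_graph G" and "unicycle G"
    and "is_cycle_of G C" and "k = card (verts C)"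
  shows "(k = 3 \<longrightarrow> greedoid (verts G) (Psi G)) \<and>
    (\<forall>q. k = 2 * q \<and> 2 * q \<ge> 4 \<longrightarrow>
      (greedoid (verts G) (Psi G) \<longleftrightarrow>
        (\<forall>M. maximum_matching G M \<longrightarrow> uniquely_restricted G M))) \<and>
    (\<forall>q. k = 2 * q + 1 \<and> 2 * q + 1 \<ge> 5 \<longrightarrow>
      (greedoid (verts G) (Psi G) \<longleftrightarrow>
        (\<forall>S \<in> Psi G. konig_egervary (induced G (closed_nbhd G S)))))"
proof -
  interpret fin_simple_graph G
    using assms(1) by unfold_locales
  have C: "D = C" if "is_cycle_of G D" for D
    using assms(2,3) that unfolding unicycle_def by blast
  have "accessible" if "k = 3"
    using accessible_if_triangle[of "verts C"] C that assms(4) by auto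
  moreover have "accessible \<longleftrightarrow> (\<forall>M. maximum_matching G M \<longrightarrow> uniquely_restricted G M)"
    if "even k"
  proof -
    have "hall_local S" if "S \<in> Psi G" for S
      using hall_local_if_no_odd_cycle[OF that] C \<open>even k\<close> assms(4) by auto
    then show ?thesis
      using accessible_if_uniquely_restricted uniquely_restricted_if_accessible by blast
  qed
  moreover have "accessible \<longleftrightarrow> (\<forall>S \<in> Psi G. konig_egervary (induced G (closed_nbhd G S)))"
    if "odd k" "k \<noteq> 3"
  proof -
    \<comment> \<open>The absence of even cycles serves to derive accessibility from Hall's
      condition, the absence of triangles serves the converse.\<close>
    have "odd (card (verts D))" "card (verts D) \<noteq> 3" if "is_cycle_of G D" for D
      using C[OF that] \<open>odd k\<close> \<open>k \<noteq> 3\<close> assms(4) by auto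
    then show ?thesis
      using accessible_if_hall_local hall_local_if_accessible konig_egervary_iff by blast
  qed
  ultimately show ?thesis
    unfolding greedoid_iff by auto
qed

end
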